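(* Let $\mathbb{F}$ be an infinite field. There exist a polynomial function $q$ and an absolute constant $c$ such that the following holds. Let $P(\mathbf{x},y)\in\mathbb{F}[x_1,\dots,x_n,y]$ be computed by an algebraic circuit $C$, and let $\varphi(\mathbf{x})\in\mathbb{F}[[x_1,\dots,x_n]]$ satisfy $\varphi(\mathbf{0})=0$, $P(\mathbf{x},\varphi(\mathbf{x}))=0$ and $\partial_yP(\mathbf{0},0)\neq 0$. Then for every $d\in\mathbb{N}$ there is an algebraic circuit $C'$ computing $\mathrm{Hom}_{\le d}[\varphi]$ with $\mathrm{size}(C')\le q(d,\mathrm{size}(C))$ and $\mathrm{depth}(C')\le \mathrm{depth}(C)+c$.
   Context: Algebraic circuits: directed acyclic graphs with leaves labelled by variables or field constants, internal gates $+$ and $\times$, and field constants on edges; size is the number of wires, depth the length of the longest output-to-leaf path. For a power series $\varphi$ in $\mathbf{x}$, $\mathrm{Hom}_{\le d}[\varphi]$ is the polynomial obtained by keeping exactly the monomials of total degree at most $d$ (the truncation of $\varphi$ at degree $d$). *)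

theory Defs
  imports "HOL-Library.Poly_Mapping" "HOL-Computational_Algebra.Polynomial"
begin

text \<open>Monomials are finitely supported exponent vectors  nat =>0 nat  (variable i has
  exponent  Poly_Mapping.lookup m i).  Polynomials in variables indexed by nat are finitely supported
  coefficient maps; formal power series are arbitrary coefficient maps.\<close>

type_synonym 'a mpoly = "(nat \<Rightarrow>\<^sub>0 nat) \<Rightarrow>\<^sub>0 'a"
type_synonym 'a mps = "(nat \<Rightarrow>\<^sub>0 nat) \<Rightarrow> 'a"

definition mon_deg :: "(nat \<Rightarrow>\<^sub>0 nat) \<Rightarrow> nat" where
  "mon_deg m = (\<Sum>i\<in>Poly_Mapping.keys m. Poly_Mapping.lookup m i)"

definition mpoly_var :: "nat \<Rightarrow> 'a::{zero,one} mpoly" where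
  "mpoly_var i = Poly_Mapping.single (Poly_Mapping.single i 1) 1"

definition mpoly_const :: "'a::zero \<Rightarrow> 'a mpoly" where
  "mpoly_const c = Poly_Mapping.single 0 c"

definition poly_in_vars :: "nat set \<Rightarrow> 'a::zero mpoly \<Rightarrow> bool" where
  "poly_in_vars V p \<longleftrightarrow> (\<forall>m\<in>Poly_Mapping.keys p. Poly_Mapping.keys m \<subseteq> V)"

definition ps_in_vars :: "nat set \<Rightarrow> 'a::zero mps \<Rightarrow> bool" where
  "ps_in_vars V f \<longleftrightarrow> (\<forall>m. f m \<noteq> 0 \<longrightarrow> Poly_Mapping.keys m \<subseteq> V)"

definition mpoly_pderiv :: "nat \<Rightarrow> 'a::comm_ring_1 mpoly \<Rightarrow> 'a mpoly" where
  "mpoly_pderiv i p = (\<Sum>e\<in>Poly_Mapping.keys p.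
      Poly_Mapping.single (Poly_Mapping.update i (Poly_Mapping.lookup e i - 1) e)
        (of_nat (Poly_Mapping.lookup e i) * Poly_Mapping.lookup p e))"

definition mpoly_eval :: "(nat \<Rightarrow> 'a::comm_ring_1) \<Rightarrow> 'a mpoly \<Rightarrow> 'a" where
  "mpoly_eval a p = (\<Sum>e\<in>Poly_Mapping.keys p. Poly_Mapping.lookup p e * (\<Prod>i\<in>Poly_Mapping.keys e. a i ^ Poly_Mapping.lookup e i))"

definition ps_one :: "'a::{zero,one} mps" where
  "ps_one = (\<lambda>m. if m = 0 then 1 else 0)"

definition ps_monomial :: "(nat \<Rightarrow>\<^sub>0 nat) \<Rightarrow> 'a::{zero,one} mps" where
  "ps_monomial a = (\<lambda>m. if m = a then 1 else 0)"

definition ps_times :: "'a::comm_ring_1 mps \<Rightarrow> 'a mps \<Rightarrow> 'a mps" where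
  "ps_times f g = (\<lambda>m. \<Sum>(a, b)\<in>{(a, b). a + b = m}. f a * g b)"

fun ps_pow :: "'a::comm_ring_1 mps \<Rightarrow> nat \<Rightarrow> 'a mps" where
  "ps_pow f 0 = ps_one"
| "ps_pow f (Suc k) = ps_times f (ps_pow f k)"

text \<open>Substitution  P(x, phi(x)) : variable n (playing the role of y) of the polynomial P
  is replaced by the power series phi; the other variables stay.\<close>
definition subst_var_ps :: "nat \<Rightarrow> 'a::comm_ring_1 mpoly \<Rightarrow> 'a mps \<Rightarrow> 'a mps" where
  "subst_var_ps n P phi = (\<lambda>m. \<Sum>e\<in>Poly_Mapping.keys P.
      Poly_Mapping.lookup P e * ps_times (ps_monomial (Poly_Mapping.update n 0 e)) (ps_pow phi (Poly_Mapping.lookup e n)) m)"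

definition is_trunc :: "nat \<Rightarrow> 'a::zero mps \<Rightarrow> 'a mpoly \<Rightarrow> bool" where
  "is_trunc d phi Q \<longleftrightarrow> (\<forall>m. Poly_Mapping.lookup Q m = (if mon_deg m \<le> d then phi m else 0))"

text \<open>A circuit is a non-empty list of gates in topological order; gate k may only read
  gates j < k.  Leaves are variables or field constants; internal gates are + and *,
  each incoming wire carrying a field constant (pair (j, c): wire from gate j with
  constant c).  The output is the last gate.  Size = number of wires; depth = length
  of the longest path from the output to a leaf.\<close>

datatype 'a gate = Var nat | Const 'a | Add "(nat \<times> 'a) list" | Mul "(nat \<times> 'a) list"

fun gate_inputs :: "'a gate \<Rightarrow> (nat \<times> 'a) list" where
  "gate_inputs (Add ws) = ws"
| "gate_inputs (Mul ws) = ws"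
| "gate_inputs _ = []"

definition wf_circuit :: "'a gate list \<Rightarrow> bool" where
  "wf_circuit C \<longleftrightarrow> C \<noteq> [] \<and>
     (\<forall>k < length C. \<forall>(j, c) \<in> set (gate_inputs (C ! k)). j < k)"

fun gate_val :: "'a::comm_ring_1 mpoly list \<Rightarrow> 'a gate \<Rightarrow> 'a mpoly" where
  "gate_val vs (Var i) = mpoly_var i"
| "gate_val vs (Const c) = mpoly_const c"
| "gate_val vs (Add ws) = (\<Sum>(j, c)\<leftarrow>ws. mpoly_const c * vs ! j)"
| "gate_val vs (Mul ws) = (\<Prod>(j, c)\<leftarrow>ws. mpoly_const c * vs ! j)"

definition circuit_vals :: "'a::comm_ring_1 gate list \<Rightarrow> 'a mpoly list" where
  "circuit_vals C = foldl (\<lambda>vs g. vs @ [gate_val vs g]) [] C"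

definition circuit_computes :: "'a::comm_ring_1 gate list \<Rightarrow> 'a mpoly \<Rightarrow> bool" where
  "circuit_computes C p \<longleftrightarrow> wf_circuit C \<and> last (circuit_vals C) = p"

definition circuit_size :: "'a gate list \<Rightarrow> nat" where
  "circuit_size C = (\<Sum>g\<leftarrow>C. length (gate_inputs g))"

fun gate_depth :: "nat list \<Rightarrow> 'a gate \<Rightarrow> nat" where
  "gate_depth ds g = (if gate_inputs g = [] then 0
      else 1 + Max (set (map (\<lambda>(j, c). ds ! j) (gate_inputs g))))"

definition circuit_depth :: "'a gate list \<Rightarrow> nat" where
  "circuit_depth C = last (foldl (\<lambda>ds g. ds @ [gate_depth ds g]) [] C)"

end

(* Homogenize by x_i -> t x_i and let T be the part of P(t x, y) / d_y P(0,0) of total degree at most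
   d + 1 in (t, y); the coefficients of the root f(t) = phi(t x) are read off from the residue
   formula f = Res_y (y T'(y) / T(y)), where 1/T = sum_m (y - T)^m / y^(m+1) may be cut after 4(d+1)
   terms. Evaluating t and y at field constants makes this a sum of products of linear
   combinations of the bihomogeneous parts of P, and interpolation recovers the coefficients.

   P may have degree exponential in the size of C, so C must first be truncated without
   increasing its depth. Substituting y -> t beta makes every gate a polynomial in t. A
   multiplication gate is flattened to a product of powers of non-multiplication gates, and its
   truncation is a linear combination of values, at field constants, of the product of the truncated
   factors; these linear combinations are absorbed by the next layer of addition gates. If a factor
   occurs with an exponent larger than size(C)^2, then it lies at least three layers below the
   product, which leaves room to compute its truncated power from the binomial theorem. *)

theory Submission
  imports Defs "HOL-Library.FuncSet"
begin

section \<open>A residue formula for the coefficients of a root\<close>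

text \<open>Newton iteration composes circuits, so its depth grows with d. The residue formula is
  closed: one layer of products between two layers of sums, whatever d is. It divides only by the
  partial derivative at the origin and by differences of interpolation points, never by an integer
  as the usual form of Lagrange inversion does, so positive characteristic causes no trouble.

  The other obstacle is depth during truncation. Interpolating P itself in t would need more points
  than its possibly exponential degree, and truncating gate by gate would insert a layer of sums
  between consecutive layers of products. Therefore coefficients get no gates of their own: only a
  set of products spanning them is recorded, and linear algebra over the field is free until the
  next product has to read an actual value. Addition gates of C then reappear only as the sums in
  front of a product, and each product of C is rebuilt just one layer later than in C.\<close>

definition wt_ge :: "nat \<Rightarrow> nat \<Rightarrow> nat \<Rightarrow> 'a::comm_ring_1 poly poly \<Rightarrow> bool" where
  "wt_ge p q k A \<longleftrightarrow> (\<forall>a b. p * a + q * b < k \<longrightarrow> coeff (coeff A b) a = 0)"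

text \<open>Membership in the ideal generated by t^(d+1) and y^N, where y is the outer and t the
  inner variable.\<close>

definition box_zero :: "nat \<Rightarrow> nat \<Rightarrow> 'a::comm_ring_1 poly poly \<Rightarrow> bool" where
  "box_zero d N A \<longleftrightarrow> (\<forall>a\<le>d. \<forall>b<N. coeff (coeff A b) a = 0)"

lemma coeff_coeff_mult:
  fixes A B :: "'a::comm_ring_1 poly poly"
  shows "coeff (coeff (A * B) b) a
    = (\<Sum>i\<le>b. \<Sum>j\<le>a. coeff (coeff A i) j * coeff (coeff B (b - i)) (a - j))"
  by (simp add: coeff_mult coeff_sum)

lemma wt_ge_mult:
  assumes "wt_ge p q k A" "wt_ge p q l B"
  shows "wt_ge p q (k + l) (A * B)"
  unfolding wt_ge_def
proof (intro allI impI)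
  fix a b assume ab: "p * a + q * b < k + l"
  have "coeff (coeff A i) j * coeff (coeff B (b - i)) (a - j) = 0" if "i \<le> b" "j \<le> a" for i j
  proof (cases "p * j + q * i < k")
    case False
    have "p * a = p * j + p * (a - j)" "q * b = q * i + q * (b - i)"
      using that by (simp_all flip: add_mult_distrib2)
    then have "p * (a - j) + q * (b - i) < l" using False ab by linarith
    then show ?thesis using assms(2) by (simp add: wt_ge_def)
  qed (use assms(1) in \<open>simp add: wt_ge_def\<close>)
  then show "coeff (coeff (A * B) b) a = 0"
    by (simp add: coeff_coeff_mult)
qed

lemma wt_ge_power:
  assumes "wt_ge p q k A" shows "wt_ge p q (k * m) (A ^ m)"
proof (induction m)
  case 0 show ?case by (simp add: wt_ge_def)
next
  case (Suc m) then show ?case using wt_ge_mult[OF assms] by simp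
qed

lemma box_zero_mult: "box_zero d N A \<Longrightarrow> box_zero d N (B * A)"
  by (auto simp: box_zero_def coeff_coeff_mult intro!: sum.neutral)

lemma box_zero_add: "box_zero d N A \<Longrightarrow> box_zero d N B \<Longrightarrow> box_zero d N (A + B)"
  by (simp add: box_zero_def)

lemma box_zero_uminus: "box_zero d N A \<Longrightarrow> box_zero d N (- A)"
  by (simp add: box_zero_def)

lemma box_zero_diff: "box_zero d N A \<Longrightarrow> box_zero d N B \<Longrightarrow> box_zero d N (A - B)"
  by (simp add: box_zero_def)

lemma box_zero_mono: "box_zero d N A \<Longrightarrow> M \<le> N \<Longrightarrow> box_zero d M A"
  by (simp add: box_zero_def)

lemma box_zero_const: "(\<And>a. a \<le> d \<Longrightarrow> coeff r a = 0) \<Longrightarrow> box_zero d N [:r:]"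
  by (auto simp: box_zero_def coeff_pCons split: nat.splits)

text \<open>\<open>U\<close> is invertible as a power series. With V = 1 - U, the difference E - V^k
  E is a multiple of U E, and V has no constant term, so V^(d+N) lies in the ideal.\<close>

lemma box_zero_unit_cancel:
  assumes "coeff (coeff U 0) 0 = 1" "box_zero d N (U * E)"
  shows "box_zero d N E"
proof -
  have "box_zero d N (E - (1 - U) ^ k * E)" for k
  proof (induction k)
    case 0 show ?case by (simp add: box_zero_def)
  next
    case (Suc k)
    have "E - (1 - U) ^ Suc k * E = (E - (1 - U) ^ k * E) + (1 - U) ^ k * (U * E)"
      by (simp add: algebra_simps)
    then show ?case using Suc box_zero_add box_zero_mult[OF assms(2)] by metis
  qed
  moreover have "box_zero d N ((1 - U) ^ (d + N) * E)"
  proof -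
    have "wt_ge 1 1 1 (1 - U)" using assms(1) by (simp add: wt_ge_def)
    then have "wt_ge 1 1 (d + N) ((1 - U) ^ (d + N))" using wt_ge_power by fastforce
    then have "box_zero d N ((1 - U) ^ (d + N))" by (simp add: wt_ge_def box_zero_def)
    then show ?thesis by (metis box_zero_mult mult.commute)
  qed
  ultimately show ?thesis
    using box_zero_add by (metis add.commute diff_add_cancel)
qed

text \<open>The sum is y^N times the cut-off series of 1/T, so the residue of y T'/T, which is the
  coefficient of y^(-2) in T'/T, moves to y^(N-2). Modulo t^(d+1), T = (y - f) U with U a unit,
  hence T'/T = 1/(y - f) + U'/U; only the first summand has negative powers of y, and its
  coefficient at y^(-2) is f.\<close>

lemma root_coefficient_formula:
  fixes T :: "'a::idom poly poly" and f :: "'a poly"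
  defines "G \<equiv> [:0, 1:] - T"
  assumes T00: "coeff (coeff T 0) 0 = 0" and T10: "coeff (coeff T 1) 0 = 1"
    and f0: "coeff f 0 = 0"
    and root: "\<And>w. w \<le> d \<Longrightarrow> coeff (poly T f) w = 0"
    and N: "N = 4 * (d + 1)" and w: "w \<le> d"
  shows "coeff (coeff (pderiv T * (\<Sum>m<N. [:0, 1:] ^ (N - Suc m) * G ^ m)) (N - 2)) w = coeff f w"
proof -
  define Y :: "'a poly poly" where "Y = [:0, 1:]"
  define U where "U = synthetic_div T f"
  define L where "L = [:- f, 1:]"
  define r where "r = poly T f"
  define S where "S = (\<Sum>m<N. Y ^ (N - Suc m) * G ^ m)"
  define J where "J = (\<Sum>i<N. [:f:] ^ (N - Suc i) * Y ^ i)"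
  define M where "M = 2 * N - 2 * d"
  define W where "W = U * S - J"
  have T: "T = L * U + [:r:]"
    using synthetic_div_correct'[of f T] by (simp add: L_def U_def r_def)
  have Ypow: "Y ^ k = monom 1 k" for k
    by (simp add: Y_def monom_altdef)
  have NM: "N \<le> M" using N by (simp add: M_def)
  have TS: "T * S = Y ^ N - G ^ N"
    using power_diff_sumr2[of G N Y] by (simp add: S_def G_def Y_def algebra_simps)
  \<comment> \<open>With weight 2 for t, the terms of G in t alone are as heavy as y^2. So G^N has
    weight at least 2N, and its terms of t-degree at most d start only at y^(2N - 2d), well beyond
    y^N.\<close>
  have "wt_ge 2 1 2 G"
    unfolding wt_ge_def
  proof (intro allI impI)
    fix a b :: nat assume "2 * a + 1 * b < 2"
    then have "a = 0" "b = 0 \<or> b = 1" by auto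
    then show "coeff (coeff G b) a = 0" using T00 T10 by (auto simp: G_def)
  qed
  then have "wt_ge 2 1 (2 * N) (G ^ N)" by (rule wt_ge_power)
  then have GN: "box_zero d M (G ^ N)"
    by (auto simp: wt_ge_def box_zero_def M_def)
  have r: "box_zero d K [:r:]" for K
    by (intro box_zero_const) (simp add: r_def root)
  have LUS: "box_zero d M (L * U * S - Y ^ N)"
  proof -
    have "L * U * S - Y ^ N = - (G ^ N) - S * [:r:]"
      using TS by (simp add: T algebra_simps)
    then show ?thesis
      using GN r by (simp only: box_zero_diff box_zero_uminus box_zero_mult)
  qed
  \<comment> \<open>This removes the contribution of U'/U: it enters \<open>pderiv T * S\<close> as
    a multiple of \<open>L * S\<close>.\<close>
  have E: "box_zero d N (L * S)"
  proof (rule box_zero_unit_cancel)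
    have "coeff T 1 = coeff U 0 - f * coeff U 1"
      by (simp add: T L_def coeff_pCons)
    then show "coeff (coeff U 0) 0 = 1" using T10 f0 by (simp add: coeff_mult)
    have "box_zero d N (Y ^ N)" by (simp add: box_zero_def Ypow)
    then have "box_zero d N ((L * U * S - Y ^ N) + Y ^ N)"
      using box_zero_mono[OF LUS NM] by (intro box_zero_add)
    then show "box_zero d N (U * (L * S))" by (simp add: algebra_simps)
  qed
  have "pderiv T * S = U * S + pderiv U * (L * S)"
  proof -
    have "pderiv L = 1" "pderiv [:r:] = 0" by (simp_all add: L_def pderiv_pCons)
    then have "pderiv T = L * pderiv U + U"
      unfolding T by (simp only: pderiv_add pderiv_mult) simp
    then show ?thesis by (simp add: algebra_simps)
  qed
  moreover have "box_zero d N (pderiv U * (L * S))" using E by (rule box_zero_mult)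
  ultimately have 1: "coeff (coeff (pderiv T * S) (N - 2)) w = coeff (coeff (U * S) (N - 2)) w"
    using w N by (simp add: box_zero_def)
  have tf: "monom 1 k dvd f ^ k" for k
  proof -
    have "monom 1 1 dvd f" using f0 by (simp add: monom_1_dvd_iff')
    then show ?thesis using dvd_power_same[of "monom 1 1" f k] by (simp add: monom_power)
  qed
  \<comment> \<open>\<open>J\<close> is the exact quotient of y^N - f^N by y - f, and f^N vanishes
    modulo t^(d+1).\<close>
  have LW: "box_zero d M (L * W)"
  proof -
    have "Y ^ N - [:f:] ^ N = L * J"
      using power_diff_sumr2[of Y N "[:f:]"] by (simp add: J_def L_def Y_def)
    then have "L * W = (L * U * S - Y ^ N) + [:f ^ N:]"
      by (simp add: W_def poly_const_pow algebra_simps)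
    moreover have "box_zero d M [:f ^ N:]"
      using tf[of N] N by (intro box_zero_const) (simp add: monom_1_dvd_iff')
    ultimately show ?thesis using LUS box_zero_add by metis
  qed
  \<comment> \<open>\<open>L\<close> is no unit and cannot be cancelled. But its product with W
    makes each coefficient of W equal to f times the next one, and after d + 1 steps the factor
    f^(d+1) is divisible by t^(d+1).\<close>
  have "monom 1 (Suc d) dvd coeff W b - f ^ j * coeff W (b + j)" if "b + j < M" for b j
    using that
  proof (induction j)
    case (Suc j)
    have "coeff (L * W) (Suc (b + j)) = coeff W (b + j) - f * coeff W (Suc (b + j))"
      by (simp add: L_def coeff_pCons)
    then have "monom 1 (Suc d) dvd coeff W (b + j) - f * coeff W (Suc (b + j))"
      using LW Suc.prems by (simp add: box_zero_def monom_1_dvd_iff' flip: \<open>coeff (L * W) _ = _\<close>)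
    then have "monom 1 (Suc d) dvd f ^ j * (coeff W (b + j) - f * coeff W (Suc (b + j)))"
      by (rule dvd_mult)
    with Suc have "monom 1 (Suc d) dvd (coeff W b - f ^ j * coeff W (b + j))
        + f ^ j * (coeff W (b + j) - f * coeff W (Suc (b + j)))"
      by (intro dvd_add) auto
    then show ?case by (simp add: algebra_simps)
  qed simp
  \<comment> \<open>The d + 1 steps starting at N - 2 must stay below 2N - 2d, which asks for N of
    order 3d.\<close>
  moreover have "N - 2 + Suc d < M" using N by (simp add: M_def)
  ultimately have "monom 1 (Suc d) dvd coeff W (N - 2) - f ^ Suc d * coeff W (N - 2 + Suc d)"
    by blast
  moreover have "monom 1 (Suc d) dvd f ^ Suc d * coeff W (N - 2 + Suc d)"
    using tf by (rule dvd_mult2)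
  ultimately have "monom 1 (Suc d) dvd coeff W (N - 2)"
    by (metis diff_add_cancel dvd_add)
  then have "coeff (coeff (U * S) (N - 2)) w = coeff (coeff J (N - 2)) w"
    using w by (simp add: W_def monom_1_dvd_iff')
  moreover have "coeff J (N - 2) = f"
  proof -
    have "coeff ([:f:] ^ k * Y ^ i) b = (if b = i then f ^ k else 0)" for k i b
      by (simp add: Ypow poly_const_pow)
    then have "coeff J (N - 2) = (\<Sum>i<N. if N - 2 = i then f ^ (N - Suc i) else 0)"
      by (simp add: J_def coeff_sum)
    also have "\<dots> = f ^ (N - Suc (N - 2))" using N by simp
    also have "N - Suc (N - 2) = 1" using N by simp
    finally show ?thesis by simp
  qed
  ultimately show ?thesis using 1 by (simp add: S_def Y_def)
qed

section \<open>Extending circuits\<close>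

definition ordered_gates :: "'a gate list \<Rightarrow> bool" where
  "ordered_gates C \<longleftrightarrow> (\<forall>k < length C. \<forall>(j, c) \<in> set (gate_inputs (C ! k)). j < k)"

definition circuit_depths :: "'a gate list \<Rightarrow> nat list" where
  "circuit_depths C = foldl (\<lambda>ds g. ds @ [gate_depth ds g]) [] C"

lemma circuit_vals_Nil [simp]: "circuit_vals [] = []"
  and circuit_vals_snoc: "circuit_vals (C @ [g]) = circuit_vals C @ [gate_val (circuit_vals C) g]"
  by (simp_all add: circuit_vals_def)

lemma circuit_depths_Nil [simp]: "circuit_depths [] = []"
  and circuit_depths_snoc:
    "circuit_depths (C @ [g]) = circuit_depths C @ [gate_depth (circuit_depths C) g]"
  by (simp_all add: circuit_depths_def)

lemma length_circuit_vals [simp]: "length (circuit_vals C) = length C"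
  by (induction C rule: rev_induct) (simp_all add: circuit_vals_snoc)

lemma length_circuit_depths [simp]: "length (circuit_depths C) = length C"
  by (induction C rule: rev_induct) (simp_all add: circuit_depths_snoc)

lemma nth_circuit_vals_append:
  "k < length C \<Longrightarrow> circuit_vals (C @ D) ! k = circuit_vals C ! k"
proof (induction D rule: rev_induct)
  case (snoc g D)
  then show ?case
    using circuit_vals_snoc[of "C @ D" g] by (simp add: nth_append)
qed simp

lemma nth_circuit_depths_append:
  "k < length C \<Longrightarrow> circuit_depths (C @ D) ! k = circuit_depths C ! k"
proof (induction D rule: rev_induct)
  case (snoc g D)
  then show ?case
    using circuit_depths_snoc[of "C @ D" g] by (simp add: nth_append)
qed simp

lemma circuit_size_append: "circuit_size (C @ D) = circuit_size C + circuit_size D"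
  by (simp add: circuit_size_def)

lemma ordered_gates_snoc:
  "ordered_gates (C @ [g]) \<longleftrightarrow> ordered_gates C \<and> (\<forall>(j, c) \<in> set (gate_inputs g). j < length C)"
  by (auto simp: ordered_gates_def nth_append less_Suc_eq)

definition available :: "'a::comm_ring_1 gate list \<Rightarrow> 'a mpoly \<times> nat \<Rightarrow> bool" where
  "available C x \<longleftrightarrow>
    (\<exists>k<length C. circuit_vals C ! k = fst x \<and> circuit_depths C ! k \<le> snd x)"

lemma available_append: "available C x \<Longrightarrow> available (C @ D) x"
  unfolding available_def
  by (metis length_append nth_circuit_depths_append nth_circuit_vals_append trans_less_add1)

text \<open>In a pair \<open>(p, d)\<close> the number \<open>d\<close> only bounds the depth of a gate with value \<open>p\<close>. The relation
  \<open>yields A c X\<close> says that \<open>c\<close> wires suffice to extend any circuit providing \<open>A\<close> to one providing \<open>X\<close>.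
  Leaves cost nothing, since size counts wires.\<close>

definition yields ::
    "('a::comm_ring_1 mpoly \<times> nat) set \<Rightarrow> nat \<Rightarrow> ('a mpoly \<times> nat) set \<Rightarrow> bool" where
  "yields A c X \<longleftrightarrow> (\<forall>C. ordered_gates C \<and> (\<forall>x\<in>A. available C x) \<longrightarrow>
    (\<exists>D. ordered_gates (C @ D) \<and> circuit_size D \<le> c \<and> (\<forall>x\<in>X. available (C @ D) x)))"

lemma yields_refl: "X \<subseteq> A \<Longrightarrow> yields A 0 X"
  unfolding yields_def
  by (intro allI impI exI[of _ "[]"]) (auto simp: circuit_size_def)

lemma yields_mono:
  "yields A c X \<Longrightarrow> A \<subseteq> A' \<Longrightarrow> c \<le> c' \<Longrightarrow> X' \<subseteq> X \<Longrightarrow> yields A' c' X'"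
  unfolding yields_def by (meson order_trans subsetD)

text \<open>Appending gates never changes earlier ones, so everything built remains available and is
  shared: costs add instead of multiplying.\<close>

lemma yields_trans:
  assumes "yields A c X" "yields (A \<union> X) c' Y"
  shows "yields A (c + c') (X \<union> Y)"
  unfolding yields_def
proof (intro allI impI)
  fix C :: "'a gate list" assume C: "ordered_gates C \<and> (\<forall>x\<in>A. available C x)"
  then obtain D where D: "ordered_gates (C @ D)" "circuit_size D \<le> c" "\<forall>x\<in>X. available (C @ D) x"
    using assms(1) by (auto simp: yields_def)
  have "\<forall>x\<in>A \<union> X. available (C @ D) x"
    using C D available_append by blast
  then obtain D' where D': "ordered_gates ((C @ D) @ D')" "circuit_size D' \<le> c'"
      "\<forall>y\<in>Y. available ((C @ D) @ D') y"
    using assms(2) D(1) unfolding yields_def by blast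
  have "\<forall>x\<in>X \<union> Y. available ((C @ D) @ D') x"
    using D(3) D'(3) available_append by blast
  then show "\<exists>D. ordered_gates (C @ D) \<and> circuit_size D \<le> c + c' \<and>
      (\<forall>x\<in>X \<union> Y. available (C @ D) x)"
    using D D' by (intro exI[of _ "D @ D'"]) (auto simp: circuit_size_append)
qed

lemma yields_UN:
  assumes "finite I" "\<And>i. i \<in> I \<Longrightarrow> yields A (c i) (X i)"
  shows "yields A (\<Sum>i\<in>I. c i) (\<Union>i\<in>I. X i)"
  using assms
proof (induction I rule: finite_induct)
  case empty show ?case by (simp add: yields_refl)
next
  case (insert i I)
  have "yields A (c i + (\<Sum>i\<in>I. c i)) (X i \<union> (\<Union>i\<in>I. X i))"
    using insert by (intro yields_trans) (auto intro: yields_mono)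
  then show ?case using insert by simp
qed

lemma yields_snoc:
  assumes "\<And>C. ordered_gates C \<Longrightarrow> \<forall>x\<in>A. available C x \<Longrightarrow>
    \<exists>g. (\<forall>(j, c)\<in>set (gate_inputs g). j < length C) \<and> length (gate_inputs g) \<le> c \<and>
      gate_val (circuit_vals C) g = p \<and> gate_depth (circuit_depths C) g \<le> d"
  shows "yields A c {(p, d)}"
  unfolding yields_def
proof (intro allI impI)
  fix C :: "'a gate list" assume C: "ordered_gates C \<and> (\<forall>x\<in>A. available C x)"
  with assms obtain g where g: "\<forall>(j, c)\<in>set (gate_inputs g). j < length C"
      "length (gate_inputs g) \<le> c" "gate_val (circuit_vals C) g = p"
      "gate_depth (circuit_depths C) g \<le> d"
    by blast
  have "available (C @ [g]) (p, d)"
    using g unfolding available_def circuit_vals_snoc circuit_depths_snoc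
    by (intro exI[of _ "length C"]) (simp add: nth_append)
  then show "\<exists>D. ordered_gates (C @ D) \<and> circuit_size D \<le> c \<and>
      (\<forall>x\<in>{(p, d)}. available (C @ D) x)"
    using C g by (intro exI[of _ "[g]"]) (simp add: ordered_gates_snoc circuit_size_def)
qed

lemma
  shows yields_var: "yields A 0 {(mpoly_var i, d)}"
    and yields_const: "yields A 0 {(mpoly_const c, d)}"
proof -
  show "yields A 0 {(mpoly_var i, d)}"
    by (rule yields_snoc) (rule exI[of _ "Var i"], simp)
  show "yields A 0 {(mpoly_const c, d)}"
    by (rule yields_snoc) (rule exI[of _ "Const c"], simp)
qed

lemma available_indices:
  assumes "\<forall>x\<in>A. available C x" "\<forall>(p, c)\<in>set ws. \<exists>h<d. (p, h) \<in> A"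
  obtains idx where "\<And>p c. (p, c) \<in> set ws \<Longrightarrow>
    idx p < length C \<and> circuit_vals C ! idx p = p \<and> circuit_depths C ! idx p < d"
proof -
  have "\<forall>p\<in>fst ` set ws. \<exists>k. k < length C \<and> circuit_vals C ! k = p \<and> circuit_depths C ! k < d"
  proof
    fix p assume "p \<in> fst ` set ws"
    then obtain h where "h < d" "(p, h) \<in> A" using assms(2) by fastforce
    then have "available C (p, h)" using assms(1) by blast
    then show "\<exists>k. k < length C \<and> circuit_vals C ! k = p \<and> circuit_depths C ! k < d"
      using \<open>h < d\<close> by (force simp: available_def)
  qed
  then obtain idx where "\<forall>p\<in>fst ` set ws.
      idx p < length C \<and> circuit_vals C ! idx p = p \<and> circuit_depths C ! idx p < d"
    by metis
  then show ?thesis using that by force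
qed

text \<open>The bound on the inputs is strict, so empty sums and products are covered even for d =
  0.\<close>

lemma gate_depth_le:
  assumes "\<And>j c. (j, c) \<in> set (gate_inputs g) \<Longrightarrow> ds ! j < d"
  shows "gate_depth ds g \<le> d"
proof (cases "gate_inputs g = []")
  case False
  have "Max (set (map (\<lambda>(j, c). ds ! j) (gate_inputs g))) < d"
    using False assms by (subst Max_less_iff) auto
  then show ?thesis using False by (simp del: set_map Max_less_iff)
qed simp

lemma yields_Add:
  assumes "\<forall>(p, c)\<in>set ws. \<exists>h<d. (p, h) \<in> A"
  shows "yields A (length ws) {(\<Sum>(p, c)\<leftarrow>ws. mpoly_const c * p, d)}"
proof (rule yields_snoc)
  fix C assume "\<forall>x\<in>A. available C x"
  from available_indices[OF this assms] obtain idx where idx: "\<And>p c. (p, c) \<in> set ws \<Longrightarrow>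
      idx p < length C \<and> circuit_vals C ! idx p = p \<and> circuit_depths C ! idx p < d"
    by blast
  let ?ws = "map (\<lambda>(p, c). (idx p, c)) ws"
  have "map (\<lambda>(j, c). mpoly_const c * circuit_vals C ! j) ?ws = map (\<lambda>(p, c). mpoly_const c * p) ws"
    using idx by auto
  then have "gate_val (circuit_vals C) (Add ?ws) = (\<Sum>(p, c)\<leftarrow>ws. mpoly_const c * p)"
    by (simp only: gate_val.simps)
  moreover have "gate_depth (circuit_depths C) (Add ?ws) \<le> d"
    using idx by (intro gate_depth_le) auto
  moreover have "\<forall>(j, c)\<in>set (gate_inputs (Add ?ws)). j < length C" using idx by auto
  ultimately show "\<exists>g. (\<forall>(j, c)\<in>set (gate_inputs g). j < length C) \<and>
      length (gate_inputs g) \<le> length ws \<and>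
      gate_val (circuit_vals C) g = (\<Sum>(p, c)\<leftarrow>ws. mpoly_const c * p) \<and>
      gate_depth (circuit_depths C) g \<le> d"
    by (intro exI[of _ "Add ?ws"]) (simp del: gate_val.simps gate_depth.simps)
qed

lemma yields_Mul:
  assumes "\<forall>(p, c)\<in>set ws. \<exists>h<d. (p, h) \<in> A"
  shows "yields A (length ws) {(\<Prod>(p, c)\<leftarrow>ws. mpoly_const c * p, d)}"
proof (rule yields_snoc)
  fix C assume "\<forall>x\<in>A. available C x"
  from available_indices[OF this assms] obtain idx where idx: "\<And>p c. (p, c) \<in> set ws \<Longrightarrow>
      idx p < length C \<and> circuit_vals C ! idx p = p \<and> circuit_depths C ! idx p < d"
    by blast
  let ?ws = "map (\<lambda>(p, c). (idx p, c)) ws"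
  have "map (\<lambda>(j, c). mpoly_const c * circuit_vals C ! j) ?ws = map (\<lambda>(p, c). mpoly_const c * p) ws"
    using idx by auto
  then have "gate_val (circuit_vals C) (Mul ?ws) = (\<Prod>(p, c)\<leftarrow>ws. mpoly_const c * p)"
    by (simp only: gate_val.simps)
  moreover have "gate_depth (circuit_depths C) (Mul ?ws) \<le> d"
    using idx by (intro gate_depth_le) auto
  moreover have "\<forall>(j, c)\<in>set (gate_inputs (Mul ?ws)). j < length C" using idx by auto
  ultimately show "\<exists>g. (\<forall>(j, c)\<in>set (gate_inputs g). j < length C) \<and>
      length (gate_inputs g) \<le> length ws \<and>
      gate_val (circuit_vals C) g = (\<Prod>(p, c)\<leftarrow>ws. mpoly_const c * p) \<and>
      gate_depth (circuit_depths C) g \<le> d"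
    by (intro exI[of _ "Mul ?ws"]) (simp del: gate_val.simps gate_depth.simps)
qed

lemma mpoly_const_1 [simp]: "mpoly_const 1 = 1"
  by (simp add: mpoly_const_def)

lemma mpoly_const_0 [simp]: "mpoly_const 0 = 0"
  by (simp add: mpoly_const_def)

lemma mpoly_const_add: "mpoly_const (a + b) = mpoly_const a + mpoly_const b"
  by (simp add: mpoly_const_def single_add)

lemma mpoly_const_mult: "mpoly_const (a * b) = mpoly_const a * mpoly_const b"
  by (simp add: mpoly_const_def mult_single)

lemma mpoly_const_diff: "mpoly_const (a - b) = mpoly_const a - mpoly_const (b :: 'a::comm_ring_1)"
  by (simp add: mpoly_const_def single_diff)

lemma mpoly_const_power: "mpoly_const (a ^ k) = mpoly_const (a :: 'a::comm_ring_1) ^ k"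
  by (induction k) (simp_all add: mpoly_const_mult)

interpretation mpoly: vector_space "\<lambda>c p. mpoly_const (c :: 'a::field) * p"
  by unfold_locales (simp_all add: mpoly_const_add mpoly_const_mult algebra_simps)

lemma mpoly_span_trans:
  assumes "x \<in> mpoly.span S" and "\<And>s. s \<in> S \<Longrightarrow> s \<in> mpoly.span T"
  shows "x \<in> mpoly.span T"
proof -
  have "S \<subseteq> mpoly.span T" using assms(2) by (rule subsetI)
  then have "mpoly.span S \<subseteq> mpoly.span T" by (rule mpoly.span_minimal[OF _ mpoly.subspace_span])
  then show ?thesis using assms(1) by (rule subsetD)
qed

text \<open>Constants on wires are free, so one addition gate realizes any linear combination: a
  span is what one extra layer can compute.\<close>

lemma yields_span:
  fixes p :: "'a::field mpoly"
  assumes "finite B" "p \<in> mpoly.span B" "\<And>b. b \<in> B \<Longrightarrow> \<exists>h<d. (b, h) \<in> A"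
  shows "yields A (card B) {(p, d)}"
proof -
  obtain u where p: "p = (\<Sum>b\<in>B. mpoly_const (u b) * b)"
    using assms(1,2) by (auto simp: mpoly.span_finite)
  obtain bs where bs: "set bs = B" "distinct bs"
    using assms(1) finite_distinct_list by blast
  let ?ws = "map (\<lambda>b. (b, u b)) bs"
  have "yields A (length ?ws) {(\<Sum>(p, c)\<leftarrow>?ws. mpoly_const c * p, d)}"
    using assms(3) bs by (intro yields_Add) auto
  moreover have "(\<Sum>(p, c)\<leftarrow>?ws. mpoly_const c * p) = p"
    using bs p by (simp add: sum_list_distinct_conv_sum_set comp_def)
  moreover have "length ?ws = card B" using bs distinct_card by fastforce
  ultimately show ?thesis by simp
qed

text \<open>Powers come from parallel wires, which takes one layer but as many wires as the sum of
  the exponents. Exponential exponents therefore need another treatment.\<close>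

lemma yields_prod_power:
  fixes f :: "'i \<Rightarrow> 'a::field mpoly"
  assumes "finite I" "\<And>i. i \<in> I \<Longrightarrow> \<exists>h<d. (f i, h) \<in> A"
  shows "yields A (\<Sum>i\<in>I. e i) {(\<Prod>i\<in>I. f i ^ e i, d)}"
proof -
  obtain xs where xs: "set xs = I" "distinct xs"
    using assms(1) finite_distinct_list by blast
  let ?ws = "concat (map (\<lambda>i. replicate (e i) (f i, 1 :: 'a)) xs)"
  have "yields A (length ?ws) {(\<Prod>(p, c)\<leftarrow>?ws. mpoly_const c * p, d)}"
  proof (rule yields_Mul)
    show "\<forall>(p, c)\<in>set ?ws. \<exists>h<d. (p, h) \<in> A" using assms(2) xs by auto
  qed
  moreover have "(\<Prod>(p, c)\<leftarrow>?ws. mpoly_const c * p) = (\<Prod>i\<leftarrow>xs. f i ^ e i)"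
    by (induction xs) (simp_all add: prod_list_replicate)
  moreover have "(\<Prod>i\<leftarrow>xs. f i ^ e i) = (\<Prod>i\<in>I. f i ^ e i)"
    using xs prod.distinct_set_conv_list by metis
  moreover have "length ?ws = (\<Sum>i\<leftarrow>xs. e i)"
    by (induction xs) simp_all
  moreover have "(\<Sum>i\<leftarrow>xs. e i) = (\<Sum>i\<in>I. e i)"
    using xs sum.distinct_set_conv_list by metis
  ultimately show ?thesis by simp
qed

lemma circuit_of_yields:
  assumes "yields {} c {(p, d)}"
  shows "\<exists>C. circuit_computes C p \<and> circuit_size C \<le> Suc c \<and> circuit_depth C \<le> Suc d"
proof -
  have "ordered_gates ([] :: 'a gate list)" by (simp add: ordered_gates_def)
  then obtain C where C: "ordered_gates ([] @ C)" "circuit_size C \<le> c" "available ([] @ C) (p, d)"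
    using assms unfolding yields_def by blast
  then obtain k where k: "k < length C" "circuit_vals C ! k = p" "circuit_depths C ! k \<le> d"
    by (auto simp: available_def)
  \<comment> \<open>The output must be the last gate, so the wanted value is copied; this costs one
    wire and one layer.\<close>
  let ?g = "Add [(k, 1)]"
  have "wf_circuit (C @ [?g])"
    using C k ordered_gates_snoc[of C ?g] by (simp add: wf_circuit_def ordered_gates_def)
  moreover have "last (circuit_vals (C @ [?g])) = p"
    using k by (simp add: circuit_vals_snoc)
  moreover have "circuit_depth (C @ [?g]) \<le> Suc d"
    using k unfolding circuit_depth_def circuit_depths_def[symmetric] circuit_depths_snoc by simp
  ultimately show ?thesis
    using C by (intro exI[of _ "C @ [?g]"]) (simp add: circuit_computes_def circuit_size_def)
qed

section \<open>Interpolation\<close>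

text \<open>Dividing off X - a leaves a quotient whose values at the other points are divided
  differences of f, so induction on the point set applies. The weights are field constants although
  the coefficients of f are polynomials.\<close>

lemma coeff_in_span_evals:
  fixes f :: "'a::field mpoly poly"
  assumes "finite A" "degree f < card A"
  shows "coeff f w \<in> mpoly.span ((\<lambda>a. poly f (mpoly_const a)) ` A)"
  using assms
proof (induction A arbitrary: f w rule: finite_induct)
  case (insert a A)
  let ?S = "mpoly.span ((\<lambda>a. poly f (mpoly_const a)) ` insert a A)"
  let ?c = mpoly_const
  define g where "g = synthetic_div f (?c a)"
  have f: "f = [:- ?c a, 1:] * g + [:poly f (?c a):]"
    using synthetic_div_correct'[of "?c a" f] by (simp add: g_def)
  have g: "coeff g v \<in> ?S" for v
  proof (cases "degree f = 0")
    case True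
    then have "g = 0" by (simp add: g_def synthetic_div_eq_0_iff)
    then show ?thesis by (simp add: mpoly.span_zero)
  next
    case False
    then have "degree g < card A" using insert.prems insert.hyps by (simp add: g_def degree_synthetic_div)
    then have "coeff g v \<in> mpoly.span ((\<lambda>a. poly g (?c a)) ` A)" by (rule insert.IH)
    moreover have "poly g (?c b) \<in> ?S" if b: "b \<in> A" for b
    proof -
      have "poly f (?c b) - poly f (?c a) = ?c (b - a) * poly g (?c b)"
        by (subst f) (simp add: mpoly_const_diff algebra_simps)
      then have "poly g (?c b) = ?c (inverse (b - a)) * (poly f (?c b) - poly f (?c a))"
      proof -
        have "inverse (b - a) * (b - a) = 1" using b insert.hyps by (intro left_inverse) auto
        then show ?thesis
          using \<open>poly f (?c b) - _ = _\<close>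
          by (simp only: mult.assoc[symmetric] mpoly_const_mult[symmetric]) simp
      qed
      then show ?thesis
        using b by (auto intro!: mpoly.span_scale mpoly.span_diff intro: mpoly.span_base)
    qed
    ultimately show ?thesis
      by - (erule mpoly_span_trans, elim imageE, simp)
  qed
  have fa: "poly f (?c a) \<in> ?S" by (auto intro: mpoly.span_base)
  have "coeff f w = (if w = 0 then poly f (?c a) else coeff g (w - 1)) - ?c a * coeff g w"
    by (subst f) (simp add: coeff_pCons split: nat.split)
  moreover have "(if w = 0 then poly f (?c a) else coeff g (w - 1)) - ?c a * coeff g w \<in> ?S"
    using g fa by (intro mpoly.span_diff mpoly.span_scale) auto
  ultimately show ?case by simp
qed simp

lemma coeff_coeff_in_span_evals:
  fixes F :: "'a::field mpoly poly poly"
  assumes "finite A" "finite B" "degree F < card B"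
    and "\<And>b. b \<in> B \<Longrightarrow> degree (poly F [:mpoly_const b:]) < card A"
  shows "coeff (coeff F k) w \<in>
    mpoly.span ((\<lambda>(a, b). poly (poly F [:mpoly_const b:]) (mpoly_const a)) ` (A \<times> B))"
    (is "_ \<in> ?S")
proof -
  \<comment> \<open>The coefficient of t^w as a polynomial in y: interpolation is done first in y,
    then in t for each value of y.\<close>
  define g where "g = map_poly (\<lambda>c. coeff c w) F"
  have cg: "coeff g i = coeff (coeff F i) w" for i by (simp add: g_def coeff_map_poly)
  have "degree g \<le> degree F" by (intro degree_le) (simp add: cg coeff_eq_0)
  then have "degree g < card B" using assms(3) by simp
  then have "coeff g k \<in> mpoly.span ((\<lambda>b. poly g (mpoly_const b)) ` B)"
    using assms(2) by (intro coeff_in_span_evals)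
  moreover have "poly g (mpoly_const b) \<in> ?S" if "b \<in> B" for b
  proof -
    have "poly g (mpoly_const b) = (\<Sum>i\<le>degree F. coeff (coeff F i) w * mpoly_const b ^ i)"
    proof -
      have "coeff (coeff F i) w = 0" if "degree g < i" for i
        using coeff_eq_0[OF that] cg by simp
      then show ?thesis
        unfolding poly_altdef cg using \<open>degree g \<le> degree F\<close>
        by (intro sum.mono_neutral_left) auto
    qed
    also have "\<dots> = coeff (poly F [:mpoly_const b:]) w"
      by (simp add: poly_altdef coeff_sum poly_const_pow mult.commute)
    also have "\<dots> \<in> mpoly.span ((\<lambda>a. poly (poly F [:mpoly_const b:]) (mpoly_const a)) ` A)"
      using assms that by (intro coeff_in_span_evals) auto
    also have "\<dots> \<subseteq> ?S" using that by (intro mpoly.span_mono) auto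
    finally show ?thesis .
  qed
  ultimately show ?thesis
    unfolding cg by - (erule mpoly_span_trans, elim imageE, simp)
qed

section \<open>Truncating a circuit without increasing its depth\<close>

lemma gate_val_cong:
  "(\<And>j c. (j, c) \<in> set (gate_inputs g) \<Longrightarrow> vs ! j = vs' ! j) \<Longrightarrow> gate_val vs g = gate_val vs' g"
  by (cases g) (auto intro!: arg_cong[where f = sum_list] arg_cong[where f = prod_list])

lemma gate_depth_cong:
  assumes "\<And>j c. (j, c) \<in> set (gate_inputs g) \<Longrightarrow> ds ! j = ds' ! j"
  shows "gate_depth ds g = gate_depth ds' g"
proof -
  have "map (\<lambda>(j, c). ds ! j) (gate_inputs g) = map (\<lambda>(j, c). ds' ! j) (gate_inputs g)"
    using assms by auto
  then show ?thesis by (simp only: gate_depth.simps)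
qed

lemma nth_circuit_vals:
  assumes "ordered_gates C" "k < length C"
  shows "circuit_vals C ! k = gate_val (circuit_vals C) (C ! k)"
proof -
  let ?B = "take k C"
  have C: "C = (?B @ [C ! k]) @ drop (Suc k) C"
    using assms(2) by (simp add: id_take_nth_drop[symmetric])
  have "circuit_vals C ! k = circuit_vals (?B @ [C ! k]) ! k"
    using assms(2) nth_circuit_vals_append[of k "?B @ [C ! k]" "drop (Suc k) C"] C by simp
  also have "\<dots> = gate_val (circuit_vals ?B) (C ! k)"
    using assms(2) by (simp add: circuit_vals_snoc nth_append)
  also have "\<dots> = gate_val (circuit_vals C) (C ! k)"
  proof (rule gate_val_cong)
    fix j c assume "(j, c) \<in> set (gate_inputs (C ! k))"
    then have "j < k" using assms by (auto simp: ordered_gates_def)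
    then show "circuit_vals ?B ! j = circuit_vals C ! j"
      using assms(2) nth_circuit_vals_append[of j ?B "drop k C"] by simp
  qed
  finally show ?thesis .
qed

lemma nth_circuit_depths:
  assumes "ordered_gates C" "k < length C"
  shows "circuit_depths C ! k = gate_depth (circuit_depths C) (C ! k)"
proof -
  let ?B = "take k C"
  have C: "C = (?B @ [C ! k]) @ drop (Suc k) C"
    using assms(2) by (simp add: id_take_nth_drop[symmetric])
  have "circuit_depths C ! k = circuit_depths (?B @ [C ! k]) ! k"
    using assms(2) nth_circuit_depths_append[of k "?B @ [C ! k]" "drop (Suc k) C"] C by simp
  also have "\<dots> = gate_depth (circuit_depths ?B) (C ! k)"
    using assms(2) by (simp add: circuit_depths_snoc nth_append)
  also have "\<dots> = gate_depth (circuit_depths C) (C ! k)"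
  proof (rule gate_depth_cong)
    fix j c assume "(j, c) \<in> set (gate_inputs (C ! k))"
    then have "j < k" using assms by (auto simp: ordered_gates_def)
    then show "circuit_depths ?B ! j = circuit_depths C ! j"
      using assms(2) nth_circuit_depths_append[of j ?B "drop k C"] by simp
  qed
  finally show ?thesis .
qed

lemma depth_input_less:
  assumes "ordered_gates C" "k < length C" "(j, c) \<in> set (gate_inputs (C ! k))"
  shows "circuit_depths C ! j < circuit_depths C ! k"
proof -
  let ?S = "set (map (\<lambda>(j, c). circuit_depths C ! j) (gate_inputs (C ! k)))"
  have "circuit_depths C ! j \<in> ?S" using assms(3) by force
  then have "circuit_depths C ! j \<le> Max ?S" by (intro Max_ge) simp_all
  moreover have "gate_inputs (C ! k) \<noteq> []" using assms(3) by auto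
  ultimately show ?thesis
    using nth_circuit_depths[OF assms(1,2)] by (simp del: set_map)
qed

section \<open>Polynomials in t modulo t^(D+1)\<close>

definition trunc_eq :: "nat \<Rightarrow> 'a::comm_ring_1 poly \<Rightarrow> 'a poly \<Rightarrow> bool" where
  "trunc_eq D p q \<longleftrightarrow> (\<forall>w\<le>D. coeff p w = coeff q w)"

lemma trunc_eq_refl [simp]: "trunc_eq D p p"
  by (simp add: trunc_eq_def)

lemma trunc_eq_mult: "trunc_eq D p p' \<Longrightarrow> trunc_eq D q q' \<Longrightarrow> trunc_eq D (p * q) (p' * q')"
  by (auto simp: trunc_eq_def coeff_mult intro!: sum.cong)

lemma trunc_eq_power: "trunc_eq D p q \<Longrightarrow> trunc_eq D (p ^ k) (q ^ k)"
  by (induction k) (simp_all add: trunc_eq_mult)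

lemma trunc_eq_prod: "(\<And>i. i \<in> I \<Longrightarrow> trunc_eq D (f i) (g i)) \<Longrightarrow> trunc_eq D (\<Prod>i\<in>I. f i) (\<Prod>i\<in>I. g i)"
  by (induction I rule: infinite_finite_induct) (simp_all add: trunc_eq_mult)

lemma trunc_eq_cutoff: "trunc_eq D (poly_cutoff (Suc D) p) p"
  by (simp add: trunc_eq_def coeff_poly_cutoff)

lemma degree_poly_cutoff: "degree (poly_cutoff (Suc D) p) \<le> D"
  by (rule degree_le) (simp add: coeff_poly_cutoff)

lemma eval_in_span:
  fixes p :: "'a::field mpoly poly"
  assumes "\<And>w. coeff p w \<in> mpoly.span B"
  shows "poly p (mpoly_const a) \<in> mpoly.span B"
proof -
  have "poly p (mpoly_const a) = (\<Sum>w\<le>degree p. mpoly_const (a ^ w) * coeff p w)"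
    by (simp add: poly_altdef mpoly_const_power mult.commute)
  then show ?thesis using assms by (auto intro!: mpoly.span_sum mpoly.span_scale)
qed

lemma of_nat_mpoly: "(of_nat k :: 'a::comm_ring_1 mpoly) = mpoly_const (of_nat k)"
  by (induction k) (simp_all add: mpoly_const_add)

text \<open>Without its constant term \<open>p\<close> is nilpotent modulo \<open>t ^ (D + 1)\<close>, so that only the first \<open>D + 1\<close>
  terms of the binomial expansion of \<open>p ^ e\<close> matter, however large \<open>e\<close> is.\<close>

lemma power_coeff_in_span:
  fixes p :: "'a::field mpoly poly"
  assumes "coeff p 0 = mpoly_const c" "w \<le> D"
  defines "v \<equiv> poly_cutoff (Suc D) p - [:mpoly_const c:]"
  assumes A: "finite A" "D * D < card A"
  shows "coeff (p ^ e) w \<in> mpoly.span ((\<lambda>(a, j). poly v (mpoly_const a) ^ j) ` (A \<times> {..D}))"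
    (is "_ \<in> ?S")
proof -
  let ?c = "mpoly_const c"
  have v0: "coeff v 0 = 0" by (simp add: v_def coeff_poly_cutoff assms(1))
  have "degree v \<le> D"
    unfolding v_def using degree_poly_cutoff[of D p] by (intro degree_diff_le) simp_all
  then have deg: "degree (v ^ j) < card A" if "j \<le> D" for j
    using degree_power_le[of v j] mult_le_mono[OF \<open>degree v \<le> D\<close> that] A(2) by linarith
  have vj: "coeff (v ^ j) w = 0" if "D < j" for j
  proof -
    have "monom 1 1 dvd v" using v0 by (simp add: monom_1_dvd_iff')
    then have "monom 1 j dvd v ^ j"
      using dvd_power_same[of "monom 1 1" v j] by (simp add: monom_power)
    then show ?thesis using assms(2) that by (simp add: monom_1_dvd_iff')
  qed
  have "coeff (p ^ e) w = coeff ((v + [:?c:]) ^ e) w"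
    using trunc_eq_power[OF trunc_eq_cutoff[of D p], of e] assms(2)
    by (simp add: v_def trunc_eq_def)
  also have "\<dots> = (\<Sum>j\<le>e. mpoly_const (of_nat (e choose j) * c ^ (e - j)) * coeff (v ^ j) w)"
    unfolding binomial_ring
    by (simp add: coeff_sum poly_const_pow of_nat_poly of_nat_mpoly mpoly_const_mult
        mpoly_const_power mult_ac)
  also have "\<dots> \<in> ?S"
  proof (intro mpoly.span_sum mpoly.span_scale)
    fix j
    show "coeff (v ^ j) w \<in> ?S"
    proof (cases "j \<le> D")
      case True
      have "coeff (v ^ j) w \<in> mpoly.span ((\<lambda>a. poly (v ^ j) (mpoly_const a)) ` A)"
        using A(1) deg[OF True] by (rule coeff_in_span_evals)
      also have "\<dots> \<subseteq> ?S" using True by (intro mpoly.span_mono) auto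
      finally show ?thesis .
    qed (use vj in \<open>simp add: mpoly.span_zero\<close>)
  qed
  finally show ?thesis .
qed

lemma prod_list_factor:
  fixes V :: "nat \<Rightarrow> 'a::comm_ring_1 mpoly poly"
  assumes "\<And>x. x \<in> set ws \<Longrightarrow> F x = [:mpoly_const (\<kappa> x):] * (\<Prod>i\<in>I. V i ^ e x i)"
  shows "prod_list (map F ws)
    = [:mpoly_const (prod_list (map \<kappa> ws)):] * (\<Prod>i\<in>I. V i ^ (\<Sum>x\<leftarrow>ws. e x i))"
  using assms
proof (induction ws)
  case Nil show ?case by simp
next
  case (Cons x ws)
  have "prod_list (map F (x # ws)) = [:mpoly_const (\<kappa> x):] * (\<Prod>i\<in>I. V i ^ e x i) *
      ([:mpoly_const (prod_list (map \<kappa> ws)):] * (\<Prod>i\<in>I. V i ^ (\<Sum>x\<leftarrow>ws. e x i)))"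
    using Cons by simp
  also have "\<dots> = ([:mpoly_const (\<kappa> x):] * [:mpoly_const (prod_list (map \<kappa> ws)):]) *
      ((\<Prod>i\<in>I. V i ^ e x i) * (\<Prod>i\<in>I. V i ^ (\<Sum>x\<leftarrow>ws. e x i)))"
    by (simp only: mult_ac)
  also have "\<dots> = [:mpoly_const (prod_list (map \<kappa> (x # ws))):] *
      (\<Prod>i\<in>I. V i ^ (\<Sum>x\<leftarrow>x # ws. e x i))"
    by (simp add: prod.distrib[symmetric] power_add mpoly_const_mult mult_ac)
  finally show ?case .
qed

text \<open>\<open>G\<close> abstracts the substitution of t times x_i for x_i and of t times a
  fixed constant for y. The number of points exceeds both degrees that will be interpolated: at most
  s factors of degree D (s^2 + 1), and powers of degree at most D^2.\<close>

locale graded_circuit =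
  fixes G :: "'a::field mpoly \<Rightarrow> 'a mpoly poly" and C :: "'a gate list" and D :: nat and A :: "'a set"
  assumes G_add: "G (p + q) = G p + G q"
    and G_mult: "G (p * q) = G p * G q"
    and G_const: "G (mpoly_const c) = [:mpoly_const c:]"
    and G_var: "\<exists>x. G (mpoly_var i) = monom x 1 \<and> (\<exists>j c. x = mpoly_var j \<or> x = mpoly_const c)"
    and wf: "wf_circuit C"
    and finA: "finite A"
    and cardA: "card A = circuit_size C * D * (circuit_size C ^ 2 + 1) + D * D + 1"
begin

definition V where "V k = G (circuit_vals C ! k)"
definition dep where "dep k = circuit_depths C ! k"
text \<open>A circuit may contain any number of leaves that no gate reads, so its length is not
  bounded by its size. Only gates that are read, and the output in \<open>R\<close>, can be
  counted.\<close>

definition I where "I = (\<Union>k<length C. fst ` set (gate_inputs (C ! k)))"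
definition R where "R = insert (length C - 1) I"
definition s where "s = circuit_size C"
definition is_mul where "is_mul k \<longleftrightarrow> (\<exists>ws. C ! k = Mul ws)"

lemma ordered: "ordered_gates C" and nonempty: "0 < length C"
  using wf by (simp_all add: wf_circuit_def ordered_gates_def)

lemma G_0: "G 0 = 0" using G_const[of 0] by simp
lemma G_1: "G 1 = 1" using G_const[of 1] by (simp add: one_pCons)

lemma V_Add: "k < length C \<Longrightarrow> C ! k = Add ws \<Longrightarrow> V k = (\<Sum>(j, c)\<leftarrow>ws. [:mpoly_const c:] * V j)"
proof -
  have "G (\<Sum>(j, c)\<leftarrow>ws. mpoly_const c * vs ! j) = (\<Sum>(j, c)\<leftarrow>ws. [:mpoly_const c:] * G (vs ! j))" for vs
    by (induction ws) (auto simp: G_0 G_add G_mult G_const)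
  then show "k < length C \<Longrightarrow> C ! k = Add ws \<Longrightarrow> ?thesis"
    by (simp add: V_def nth_circuit_vals[OF ordered, of k])
qed

lemma V_Mul: "k < length C \<Longrightarrow> C ! k = Mul ws \<Longrightarrow> V k = (\<Prod>(j, c)\<leftarrow>ws. [:mpoly_const c:] * V j)"
proof -
  have "G (\<Prod>(j, c)\<leftarrow>ws. mpoly_const c * vs ! j) = (\<Prod>(j, c)\<leftarrow>ws. [:mpoly_const c:] * G (vs ! j))" for vs
    by (induction ws) (auto simp: G_1 G_mult G_const)
  then show "k < length C \<Longrightarrow> C ! k = Mul ws \<Longrightarrow> ?thesis"
    by (simp add: V_def nth_circuit_vals[OF ordered, of k])
qed

lemma V_Var: "k < length C \<Longrightarrow> C ! k = Var i \<Longrightarrow> V k = G (mpoly_var i)"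
  and V_Const: "k < length C \<Longrightarrow> C ! k = Const c \<Longrightarrow> V k = [:mpoly_const c:]"
  by (simp_all add: V_def nth_circuit_vals[OF ordered, of k] G_const)

lemma input:
  assumes "k < length C" "(j, c) \<in> set (gate_inputs (C ! k))"
  shows "j < k" "j \<in> I" "dep j < dep k"
  using assms ordered depth_input_less[OF ordered] by (force simp: ordered_gates_def I_def dep_def)+

lemma finite_I: "finite I" by (simp add: I_def)

lemma card_I: "card I \<le> s"
proof -
  have "card I \<le> (\<Sum>k<length C. card (fst ` set (gate_inputs (C ! k))))"
    unfolding I_def by (rule card_UN_le) simp
  also have "\<dots> \<le> (\<Sum>k<length C. length (gate_inputs (C ! k)))"
    by (intro sum_mono) (meson List.finite_set card_image_le card_length order_trans)
  also have "\<dots> = s"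
    by (simp add: s_def circuit_size_def sum_list_sum_nth atLeast0LessThan)
  finally show ?thesis .
qed

lemma I_less: "i \<in> I \<Longrightarrow> i < length C"
  unfolding I_def using input(1) by fastforce

lemma R_less: "i \<in> R \<Longrightarrow> i < length C"
  using I_less nonempty by (auto simp: R_def)

lemma finite_R: "finite R" and card_R: "card R \<le> s + 1"
  using finite_I card_I by (auto simp: R_def card_insert_if)

lemma fanin_le: "k < length C \<Longrightarrow> length (gate_inputs (C ! k)) \<le> s"
  unfolding s_def circuit_size_def by (rule member_le_sum_list) auto

text \<open>At t = 0 all variables disappear. The resulting field constant is what the binomial
  expansion of large powers is centred at.\<close>

lemma constant_coeff: "k < length C \<Longrightarrow> \<exists>c. coeff (V k) 0 = mpoly_const c"
proof (induction k rule: less_induct)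
  case (less k)
  show ?case
  proof (cases "C ! k")
    case (Var i)
    then obtain x where "V k = monom x 1" using V_Var less.prems G_var by metis
    then show ?thesis by (intro exI[of _ 0]) simp
  next
    case (Const c)
    then show ?thesis using V_Const less.prems by auto
  next
    case (Add ws)
    have "\<exists>c. coeff (V j) 0 = mpoly_const c" if "(j, c) \<in> set ws" for j c
      using less that Add input(1)[OF less.prems] by (metis gate_inputs.simps(1) less_trans)
    then have "\<exists>c. coeff (\<Sum>(j, c)\<leftarrow>ws. [:mpoly_const c:] * V j) 0 = mpoly_const c"
    proof (induction ws)
      case Nil show ?case by (intro exI[of _ 0]) simp
    next
      case (Cons w ws)
      obtain j c where w: "w = (j, c)" by fastforce
      obtain a b where "coeff (V j) 0 = mpoly_const a"
          "coeff (\<Sum>(j, c)\<leftarrow>ws. [:mpoly_const c:] * V j) 0 = mpoly_const b"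
        using Cons w by (metis list.set_intros)
      then show ?case
        by (intro exI[of _ "c * a + b"]) (simp add: w mpoly_const_add mpoly_const_mult)
    qed
    then show ?thesis using V_Add less.prems Add by simp
  next
    case (Mul ws)
    have "\<exists>c. coeff (V j) 0 = mpoly_const c" if "(j, c) \<in> set ws" for j c
      using less that Mul input(1)[OF less.prems] by (metis gate_inputs.simps(2) less_trans)
    then have "\<exists>c. coeff (\<Prod>(j, c)\<leftarrow>ws. [:mpoly_const c:] * V j) 0 = mpoly_const c"
    proof (induction ws)
      case Nil show ?case by (intro exI[of _ 1]) simp
    next
      case (Cons w ws)
      obtain j c where w: "w = (j, c)" by fastforce
      obtain a b where "coeff (V j) 0 = mpoly_const a"
          "coeff (\<Prod>(j, c)\<leftarrow>ws. [:mpoly_const c:] * V j) 0 = mpoly_const b"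
        using Cons w by (metis list.set_intros)
      then show ?case
        by (intro exI[of _ "c * a * b"]) (simp add: w coeff_mult mpoly_const_mult)
    qed
    then show ?thesis using V_Mul less.prems Mul by simp
  qed
qed

text \<open>The exponent of \<open>V i\<close> counts the paths from \<open>k\<close> to \<open>i\<close> through multiplication gates, of which
  there are at most \<open>s ^ h\<close> if all of them have length at most \<open>h\<close>.\<close>

lemma factorization_aux:
  assumes "k < length C" "k \<in> I \<or> is_mul k"
  shows "\<exists>\<kappa> e. V k = [:mpoly_const \<kappa>:] * (\<Prod>i\<in>I. V i ^ e i) \<and>
    (\<forall>i. e i \<noteq> 0 \<longrightarrow> \<not> is_mul i \<and> dep i \<le> dep k \<and> (is_mul k \<longrightarrow> dep i < dep k) \<and>
      e i \<le> s ^ (dep k - dep i))"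
  using assms
proof (induction k rule: less_induct)
  case (less k)
  show ?case
  proof (cases "is_mul k")
    case False
    \<comment> \<open>A gate that does not multiply is its own factorization, which is why it has to
      lie in \<open>I\<close>.\<close>
    define e where "e i = (if i = k then 1 else 0 :: nat)" for i
    have "(\<Prod>i\<in>I. V i ^ e i) = (\<Prod>i\<in>I. if k = i then V i else 1)"
      by (intro prod.cong) (auto simp: e_def)
    then have "V k = [:mpoly_const 1:] * (\<Prod>i\<in>I. V i ^ e i)"
      using False less.prems finite_I by (simp add: prod.delta' one_pCons[symmetric])
    then show ?thesis using False by (intro exI[of _ 1] exI[of _ e]) (simp add: e_def)
  next
    case True
    then obtain ws where ws: "C ! k = Mul ws" by (auto simp: is_mul_def)
    have inp: "j < k" "j \<in> I" "dep j < dep k" if "(j, c) \<in> set ws" for j c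
      using input[OF less.prems(1)] that ws by auto
    have "\<forall>x\<in>set ws. \<exists>\<kappa> e. V (fst x) = [:mpoly_const \<kappa>:] * (\<Prod>i\<in>I. V i ^ e i) \<and>
      (\<forall>i. e i \<noteq> 0 \<longrightarrow> \<not> is_mul i \<and> dep i \<le> dep (fst x) \<and> e i \<le> s ^ (dep (fst x) - dep i))"
    proof
      fix x assume "x \<in> set ws"
      then have "(fst x, snd x) \<in> set ws" by simp
      note x = inp[OF this]
      show "\<exists>\<kappa> e. V (fst x) = [:mpoly_const \<kappa>:] * (\<Prod>i\<in>I. V i ^ e i) \<and>
        (\<forall>i. e i \<noteq> 0 \<longrightarrow> \<not> is_mul i \<and> dep i \<le> dep (fst x) \<and> e i \<le> s ^ (dep (fst x) - dep i))"
      proof -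
        have "fst x < length C" using x(1) less.prems(1) by simp
        from less.IH[OF x(1) this disjI1[OF x(2)]] show ?thesis
          by (elim exE conjE) (intro exI conjI, assumption, simp)
      qed
    qed
    from bchoice[OF this] obtain \<kappa> where "\<forall>x\<in>set ws. \<exists>e.
        V (fst x) = [:mpoly_const (\<kappa> x):] * (\<Prod>i\<in>I. V i ^ e i) \<and>
        (\<forall>i. e i \<noteq> 0 \<longrightarrow> \<not> is_mul i \<and> dep i \<le> dep (fst x) \<and> e i \<le> s ^ (dep (fst x) - dep i))"
      by blast
    from bchoice[OF this] obtain e where "\<forall>x\<in>set ws.
        V (fst x) = [:mpoly_const (\<kappa> x):] * (\<Prod>i\<in>I. V i ^ e x i) \<and>
        (\<forall>i. e x i \<noteq> 0 \<longrightarrow> \<not> is_mul i \<and> dep i \<le> dep (fst x) \<and> e x i \<le> s ^ (dep (fst x) - dep i))"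
      by blast
    then have IH: "\<And>x. x \<in> set ws \<Longrightarrow>
        V (fst x) = [:mpoly_const (\<kappa> x):] * (\<Prod>i\<in>I. V i ^ e x i)"
      "\<And>x i. x \<in> set ws \<Longrightarrow> e x i \<noteq> 0 \<Longrightarrow>
        \<not> is_mul i \<and> dep i \<le> dep (fst x) \<and> e x i \<le> s ^ (dep (fst x) - dep i)"
      by blast+
    define F where "F = (\<lambda>(j, c). [:mpoly_const c:] * V j)"
    define E where "E i = (\<Sum>x\<leftarrow>ws. e x i)" for i
    have "F x = [:mpoly_const (snd x * \<kappa> x):] * (\<Prod>i\<in>I. V i ^ e x i)" if "x \<in> set ws" for x
      using IH(1)[OF that] by (simp add: F_def case_prod_beta mpoly_const_mult)
    from prod_list_factor[OF this]
    have "V k = [:mpoly_const (prod_list (map (\<lambda>x. snd x * \<kappa> x) ws)):] * (\<Prod>i\<in>I. V i ^ E i)"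
      using V_Mul[OF less.prems(1) ws] by (simp add: F_def E_def)
    moreover have "\<not> is_mul i \<and> dep i < dep k \<and> E i \<le> s ^ (dep k - dep i)" if i: "E i \<noteq> 0" for i
    proof -
      obtain x where x: "x \<in> set ws" "e x i \<noteq> 0"
        using i by (auto simp: E_def sum_list_eq_0_iff)
      have "dep i \<le> dep (fst x)" "dep (fst x) < dep k"
        using IH(2)[OF x] inp(3)[of "fst x" "snd x"] x(1) by simp_all
      then have lt: "dep i < dep k" by simp
      have len: "length ws \<le> s" using fanin_le[OF less.prems(1)] ws by simp
      have s1: "1 \<le> s" using len x(1) by (cases ws) auto
      \<comment> \<open>Every input is at least one layer below k; at most s such bounds are added,
        which gives the missing factor s.\<close>
      have "e y i \<le> s ^ (dep k - 1 - dep i)" if y: "y \<in> set ws" for y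
      proof (cases "e y i = 0")
        case False
        have "dep (fst y) < dep k" using y inp(3)[of "fst y" "snd y"] by simp
        then have "s ^ (dep (fst y) - dep i) \<le> s ^ (dep k - 1 - dep i)"
          using s1 by (intro power_increasing) auto
        then show ?thesis using IH(2)[OF y False] by linarith
      qed simp
      then have "E i \<le> (\<Sum>x\<leftarrow>ws. s ^ (dep k - 1 - dep i))"
        unfolding E_def by (intro sum_list_mono)
      also have "\<dots> = length ws * s ^ (dep k - 1 - dep i)"
        by (simp add: sum_list_triv)
      also have "\<dots> \<le> s * s ^ (dep k - 1 - dep i)" using len by simp
      also have "\<dots> = s ^ (dep k - dep i)"
        using lt by (simp flip: power_Suc) (metis Suc_diff_Suc diff_Suc_1)
      finally show ?thesis using IH(2)[OF x] lt by simp
    qed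
    ultimately show ?thesis
      using True by (intro exI[of _ "prod_list (map (\<lambda>x. snd x * \<kappa> x) ws)"] exI[of _ E]) (auto intro: less_imp_le)
  qed
qed

end

lemma yields_weaken:
  assumes "yields A c X" "\<And>p d. (p, d) \<in> Y \<Longrightarrow> \<exists>d'\<le>d. (p, d') \<in> X"
  shows "yields A c Y"
  unfolding yields_def
proof (intro allI impI)
  fix C :: "'a gate list" assume "ordered_gates C \<and> (\<forall>x\<in>A. available C x)"
  then obtain E where E: "ordered_gates (C @ E)" "circuit_size E \<le> c" "\<forall>x\<in>X. available (C @ E) x"
    using assms(1) by (auto simp: yields_def)
  have "available (C @ E) (p, d)" if pd: "(p, d) \<in> Y" for p d
  proof -
    obtain d' where "d' \<le> d" "(p, d') \<in> X" using assms(2)[OF pd] by blast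
    then have "available (C @ E) (p, d')" using E(3) by blast
    then show ?thesis using \<open>d' \<le> d\<close> by (auto simp: available_def)
  qed
  then show "\<exists>E. ordered_gates (C @ E) \<and> circuit_size E \<le> c \<and> (\<forall>x\<in>Y. available (C @ E) x)"
    using E(1,2) by (intro exI[of _ E]) auto
qed

lemma yields_power:
  fixes f :: "'a::field mpoly"
  assumes "(f, h) \<in> A" "h < d"
  shows "yields A j {(f ^ j, d)}"
  using yields_prod_power[of "{()}" d "\<lambda>_. f" A "\<lambda>_. j"] assms by auto

section \<open>Truncated factors and the spanning products\<close>

context graded_circuit
begin

lemma factorization:
  assumes "k < length C" "is_mul k"
  shows "\<exists>e. \<exists>\<kappa>. V k = [:mpoly_const \<kappa>:] * (\<Prod>i\<in>I. V i ^ e i) \<and>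
    (\<forall>i. e i \<noteq> 0 \<longrightarrow> \<not> is_mul i \<and> dep i < dep k \<and> e i \<le> s ^ (dep k - dep i))"
proof -
  obtain \<kappa> e where "V k = [:mpoly_const \<kappa>:] * (\<Prod>i\<in>I. V i ^ e i)"
    "\<forall>i. e i \<noteq> 0 \<longrightarrow> \<not> is_mul i \<and> dep i \<le> dep k \<and> (is_mul k \<longrightarrow> dep i < dep k) \<and>
      e i \<le> s ^ (dep k - dep i)"
    using factorization_aux[OF assms(1) disjI2[OF assms(2)]] by (elim exE conjE)
  then show ?thesis using assms(2) by (intro exI[of _ e] exI[of _ \<kappa>]) simp
qed

text \<open>One choice is fixed, because the products for all interpolation points must come from
  the same factorization.\<close>

definition mexp where
  "mexp k = (SOME e. \<exists>\<kappa>. V k = [:mpoly_const \<kappa>:] * (\<Prod>i\<in>I. V i ^ e i) \<and>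
    (\<forall>i. e i \<noteq> 0 \<longrightarrow> \<not> is_mul i \<and> dep i < dep k \<and> e i \<le> s ^ (dep k - dep i)))"

lemma mexp:
  assumes "k < length C" "is_mul k"
  shows "\<exists>\<kappa>. V k = [:mpoly_const \<kappa>:] * (\<Prod>i\<in>I. V i ^ mexp k i)"
    and "mexp k i \<noteq> 0 \<Longrightarrow> \<not> is_mul i" "mexp k i \<noteq> 0 \<Longrightarrow> dep i < dep k"
    and "mexp k i \<noteq> 0 \<Longrightarrow> mexp k i \<le> s ^ (dep k - dep i)"
proof -
  have "\<exists>\<kappa>. V k = [:mpoly_const \<kappa>:] * (\<Prod>i\<in>I. V i ^ mexp k i) \<and>
    (\<forall>i. mexp k i \<noteq> 0 \<longrightarrow> \<not> is_mul i \<and> dep i < dep k \<and> mexp k i \<le> s ^ (dep k - dep i))"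
    unfolding mexp_def using factorization[OF assms] by (rule someI_ex)
  then show "\<exists>\<kappa>. V k = [:mpoly_const \<kappa>:] * (\<Prod>i\<in>I. V i ^ mexp k i)"
    and "mexp k i \<noteq> 0 \<Longrightarrow> \<not> is_mul i" "mexp k i \<noteq> 0 \<Longrightarrow> dep i < dep k"
    and "mexp k i \<noteq> 0 \<Longrightarrow> mexp k i \<le> s ^ (dep k - dep i)"
    by blast+
qed

definition cutoff where "cutoff i = poly_cutoff (Suc D) (V i)"
text \<open>Up to s^2 a power is affordable by parallel wires and raises the degree only
  polynomially. Beyond s^2 the power is truncated as a whole and enters as a single factor of degree
  at most D.\<close>

definition fac where
  "fac k i = (if mexp k i \<le> s\<^sup>2 then cutoff i ^ mexp k i else poly_cutoff (Suc D) (V i ^ mexp k i))"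
definition M where "M k a = (\<Prod>i\<in>I. poly (fac k i) (mpoly_const a))"

lemma trunc_eq_fac: "trunc_eq D (V i ^ mexp k i) (fac k i)"
proof -
  have "trunc_eq D (V i) (cutoff i)" "trunc_eq D (V i ^ mexp k i) (poly_cutoff (Suc D) (V i ^ mexp k i))"
    by (simp_all add: cutoff_def trunc_eq_def coeff_poly_cutoff)
  then show ?thesis by (simp add: fac_def trunc_eq_power)
qed

lemma degree_fac: "degree (fac k i) \<le> D * (s\<^sup>2 + 1)"
proof (cases "mexp k i \<le> s\<^sup>2")
  case True
  have "degree (cutoff i ^ mexp k i) \<le> degree (cutoff i) * mexp k i" by (rule degree_power_le)
  also have "\<dots> \<le> D * (s\<^sup>2 + 1)"
    using True degree_poly_cutoff by (intro mult_le_mono) (auto simp: cutoff_def)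
  finally show ?thesis using True by (simp add: fac_def)
next
  case False
  then have "degree (fac k i) \<le> D" by (simp add: fac_def degree_poly_cutoff)
  also have "D \<le> D * (s\<^sup>2 + 1)" by simp
  finally show ?thesis .
qed

text \<open>Truncating the factors does not change the product modulo t^(D+1), but brings its degree
  below the number of points.\<close>

lemma mul_coeff_in_span:
  assumes "k < length C" "is_mul k" "w \<le> D"
  shows "coeff (V k) w \<in> mpoly.span (M k ` A)"
proof -
  define P where "P = (\<Prod>i\<in>I. fac k i)"
  obtain \<kappa> where "V k = [:mpoly_const \<kappa>:] * (\<Prod>i\<in>I. V i ^ mexp k i)"
    using mexp(1)[OF assms(1,2)] by blast
  moreover have "trunc_eq D (\<Prod>i\<in>I. V i ^ mexp k i) P"
    unfolding P_def by (intro trunc_eq_prod trunc_eq_fac)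
  ultimately have "coeff (V k) w = mpoly_const \<kappa> * coeff P w"
    using assms(3) by (simp add: trunc_eq_def)
  moreover have "degree P < card A"
  proof -
    have "degree P \<le> (\<Sum>i\<in>I. degree (fac k i))"
      unfolding P_def using degree_prod_sum_le[OF finite_I, of "fac k"] by (simp add: comp_def)
    also have "\<dots> \<le> card I * (D * (s\<^sup>2 + 1))"
      using sum_bounded_above[of I "\<lambda>i. degree (fac k i)" "D * (s\<^sup>2 + 1)"] degree_fac by simp
    also have "\<dots> \<le> s * (D * (s\<^sup>2 + 1))" using card_I by (rule mult_right_mono) simp
    also have "\<dots> < card A" unfolding cardA s_def by (simp add: algebra_simps)
    finally show ?thesis .
  qed
  moreover have "M k = (\<lambda>a. poly P (mpoly_const a))"
    by (simp add: M_def P_def poly_prod fun_eq_iff)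
  ultimately show ?thesis
    using coeff_in_span_evals[OF finA, of P w] by (simp add: mpoly.span_scale)
qed

text \<open>\<open>Lv\<close> collects the leaves, \<open>MA h\<close> the pairs of a relevant multiplication gate of depth less than \<open>h\<close>
  and an interpolation point; \<open>B h\<close> spans the coefficients of all gates below depth \<open>h\<close>.\<close>

definition Lv where "Lv = insert 1 ((\<lambda>i. coeff (V i) 1) ` {i \<in> R. \<exists>x. C ! i = Var x})"
definition MA where "MA h = {(k, a). k \<in> R \<and> is_mul k \<and> dep k < h \<and> a \<in> A}"
definition B where "B h = Lv \<union> (\<lambda>(k, a). M k a) ` MA h"
text \<open>The elements of \<open>B h\<close> with their depths. A product sits one layer later
  than in C, since its factors are now values of linear combinations.\<close>

definition Avail where "Avail h = Lv \<times> {0} \<union> (\<lambda>(k, a). (M k a, Suc (dep k))) ` MA h"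

lemma B_mono: "h \<le> h' \<Longrightarrow> B h \<subseteq> B h'"
  by (fastforce simp: B_def MA_def)

lemma const_in_span_B: "mpoly_const c \<in> mpoly.span (B h)"
  using mpoly.span_scale[OF mpoly.span_base[of 1 "B h"], of c] by (simp add: B_def Lv_def)

text \<open>Addition adds nothing to a span: the inputs are strictly less deep, so even those that
  multiply have their coefficients in the span of \<open>B (dep i)\<close>. Only a multiplication
  gate needs products of its own depth.\<close>

lemma V_coeff_in_span:
  assumes "i \<in> R" "w \<le> D"
  shows "coeff (V i) w \<in> mpoly.span (B (if is_mul i then Suc (dep i) else dep i))"
  using assms(1)
proof (induction i rule: less_induct)
  case (less i)
  have i: "i < length C" using R_less less.prems .
  show ?case
  proof (cases "C ! i")
    case (Var x)
    then obtain y where y: "V i = monom y 1" using V_Var[OF i] G_var by metis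
    then have "y = coeff (V i) 1" by simp
    then have "y \<in> B (dep i)" using less.prems Var by (auto simp: B_def Lv_def)
    then have "coeff (V i) w \<in> mpoly.span (B (dep i))"
      using y by (auto intro: mpoly.span_base mpoly.span_zero)
    then show ?thesis using Var by (simp add: is_mul_def)
  next
    case (Const c)
    have "coeff (V i) w = (if w = 0 then mpoly_const c else 0)"
      using V_Const[OF i Const] by (simp add: coeff_pCons split: nat.split)
    then show ?thesis using Const const_in_span_B by (simp add: is_mul_def mpoly.span_zero)
  next
    case (Add ws)
    have "coeff (V j) w \<in> mpoly.span (B (dep i))" if "(j, c) \<in> set ws" for j c
    proof -
      have j: "j < i" "j \<in> I" "dep j < dep i" using input[OF i] that Add by auto
      then have "coeff (V j) w \<in> mpoly.span (B (if is_mul j then Suc (dep j) else dep j))"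
        using less.IH[of j] by (simp add: R_def)
      also have "\<dots> \<subseteq> mpoly.span (B (dep i))"
        using j(3) by (intro mpoly.span_mono B_mono) simp
      finally show ?thesis .
    qed
    then have "coeff (\<Sum>(j, c)\<leftarrow>ws. [:mpoly_const c:] * V j) w \<in> mpoly.span (B (dep i))"
    proof (induction ws)
      case (Cons x ws)
      obtain j c where x: "x = (j, c)" by fastforce
      have "coeff (V j) w \<in> mpoly.span (B (dep i))" using Cons.prems[of j c] x by simp
      moreover have "coeff (\<Sum>(j, c)\<leftarrow>ws. [:mpoly_const c:] * V j) w \<in> mpoly.span (B (dep i))"
        using Cons.prems by (intro Cons.IH) auto
      ultimately show ?case by (simp add: x mpoly.span_add mpoly.span_scale)
    qed (simp add: mpoly.span_zero)
    then show ?thesis using V_Add[OF i Add] Add by (simp add: is_mul_def)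
  next
    case (Mul ws)
    then have m: "is_mul i" by (simp add: is_mul_def)
    have "coeff (V i) w \<in> mpoly.span (M i ` A)" using i m assms(2) by (rule mul_coeff_in_span)
    also have "\<dots> \<subseteq> mpoly.span (B (Suc (dep i)))"
      using less.prems m by (intro mpoly.span_mono) (force simp: B_def MA_def)
    finally show ?thesis using m by simp
  qed
qed

section \<open>Wire counts and the construction of the spanning products\<close>

definition b where "b = (s + 2) + (s + 1) * card A"

lemma finite_MA: "finite (MA h)"
  by (rule finite_subset[of _ "R \<times> A"]) (auto simp: MA_def finite_R finA)

lemma card_MA: "card (MA h) \<le> (s + 1) * card A"
proof -
  have "card (MA h) \<le> card (R \<times> A)"
    by (intro card_mono) (auto simp: MA_def finite_R finA)
  also have "\<dots> \<le> (s + 1) * card A"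
    using card_R by (simp only: card_cartesian_product mult_le_mono1)
  finally show ?thesis .
qed

lemma finite_Lv: "finite Lv" by (simp add: Lv_def finite_R)

lemma card_Lv: "card Lv \<le> s + 2"
proof -
  let ?S = "{i \<in> R. \<exists>x. C ! i = Var x}"
  have "card Lv \<le> Suc (card ((\<lambda>i. coeff (V i) 1) ` ?S))"
    unfolding Lv_def by (rule card_insert_le_m1) simp_all
  moreover have "card ((\<lambda>i. coeff (V i) 1) ` ?S) \<le> card ?S" using finite_R by (simp add: card_image_le)
  moreover have "card ?S \<le> card R" using finite_R by (simp add: card_mono)
  ultimately show ?thesis using card_R by simp
qed

lemma finite_B: "finite (B h)" by (simp add: B_def finite_Lv finite_MA)

lemma card_B: "card (B h) \<le> b"
proof -
  have "card (B h) \<le> card Lv + card ((\<lambda>(k, a). M k a) ` MA h)"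
    unfolding B_def by (rule card_Un_le)
  also have "\<dots> \<le> (s + 2) + (s + 1) * card A"
    using card_Lv card_image_le[OF finite_MA] card_MA by (meson add_mono order_trans)
  finally show ?thesis by (simp add: b_def)
qed

text \<open>All elements of \<open>B (dep i)\<close> have depth at most \<open>dep i\<close>, so a
  single sum in the next layer suffices.\<close>

lemma yields_eval:
  assumes "dep i \<le> h" "\<And>w. coeff p w \<in> mpoly.span (B (dep i))"
  shows "yields (Avail h) b {(poly p (mpoly_const a), Suc (dep i))}"
proof -
  have "yields (Avail h) (card (B (dep i))) {(poly p (mpoly_const a), Suc (dep i))}"
  proof (rule yields_span[OF finite_B eval_in_span[OF assms(2)]])
    fix x assume "x \<in> B (dep i)"
    then show "\<exists>h'<Suc (dep i). (x, h') \<in> Avail h"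
      using assms(1) by (fastforce simp: B_def Avail_def MA_def)
  qed
  then show ?thesis by (rule yields_mono) (simp_all add: card_B)
qed

definition c2 where "c2 = card A * b + card A * (D + 1) * D + card A * (D + 1)"

lemma cutoff_coeff_in_span:
  assumes "i \<in> I" "\<not> is_mul i"
  shows "coeff (cutoff i) w \<in> mpoly.span (B (dep i))"
  using V_coeff_in_span[of i w] assms by (simp add: cutoff_def coeff_poly_cutoff R_def mpoly.span_zero)

text \<open>Three layers: the values of the part v without constant term, their powers up to D, and
  one linear combination. The exponent e affects only wire constants, not the cost.\<close>

lemma yields_large_power:
  assumes "i \<in> I" "\<not> is_mul i" "dep i \<le> h"
  shows "yields (Avail h) c2 {(poly (poly_cutoff (Suc D) (V i ^ e)) (mpoly_const a), dep i + 3)}"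
proof -
  obtain c where c: "coeff (V i) 0 = mpoly_const c"
    using constant_coeff I_less assms(1) by blast
  define v where "v = cutoff i - [:mpoly_const c:]"
  define f where "f = poly (poly_cutoff (Suc D) (V i ^ e)) (mpoly_const a)"
  define X where "X = (\<lambda>(a, j). poly v (mpoly_const a) ^ j) ` (A \<times> {..D})"
  define Y1 where "Y1 = (\<Union>a\<in>A. {(poly v (mpoly_const a), Suc (dep i))})"
  define Y2 where "Y2 = (\<Union>x\<in>A \<times> {..D}. {(poly v (mpoly_const (fst x)) ^ snd x, Suc (Suc (dep i)))})"
  have "coeff v w \<in> mpoly.span (B (dep i))" for w
  proof -
    have "coeff v w = coeff (cutoff i) w - (if w = 0 then mpoly_const c else 0)"
      by (simp add: v_def coeff_pCons split: nat.split)
    then show ?thesis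
      using cutoff_coeff_in_span[OF assms(1,2), of w] const_in_span_B[of c "dep i"]
      by (cases "w = 0") (simp_all add: mpoly.span_diff)
  qed
  then have "yields (Avail h) (\<Sum>a\<in>A. b) Y1"
    unfolding Y1_def by (intro yields_UN finA yields_eval assms(3))
  moreover have "yields (Avail h \<union> Y1) (\<Sum>x\<in>A \<times> {..D}. D) Y2"
    unfolding Y2_def
  proof (intro yields_UN)
    fix x assume x: "x \<in> A \<times> {..D}"
    have "yields (Avail h \<union> Y1) (snd x) {(poly v (mpoly_const (fst x)) ^ snd x, Suc (Suc (dep i)))}"
      by (rule yields_power[of _ "Suc (dep i)"]) (use x in \<open>auto simp: Y1_def\<close>)
    then show "yields (Avail h \<union> Y1) D {(poly v (mpoly_const (fst x)) ^ snd x, Suc (Suc (dep i)))}"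
      by (rule yields_mono) (use x in auto)
  qed (simp add: finA)
  ultimately have Y: "yields (Avail h) ((\<Sum>a\<in>A. b) + (\<Sum>x\<in>A \<times> {..D}. D)) (Y1 \<union> Y2)"
    by (rule yields_trans)
  have finX: "finite X" by (simp add: X_def finA)
  have cardX: "card X \<le> card A * (D + 1)"
    using card_image_le[of "A \<times> {..D}" "\<lambda>(a, j). poly v (mpoly_const a) ^ j"] finA
    by (simp add: X_def card_cartesian_product)
  have "coeff (V i ^ e) w \<in> mpoly.span X" if "w \<le> D" for w
    unfolding X_def v_def cutoff_def using c that finA
    by (intro power_coeff_in_span) (simp_all add: cardA)
  then have fX: "f \<in> mpoly.span X"
    unfolding f_def by (intro eval_in_span) (simp add: coeff_poly_cutoff mpoly.span_zero)
  have "yields (Avail h \<union> (Y1 \<union> Y2)) (card X) {(f, dep i + 3)}"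
  proof (rule yields_span[OF finX fX])
    fix x assume "x \<in> X"
    then have "(x, Suc (Suc (dep i))) \<in> Y2" by (auto simp: X_def Y2_def)
    then show "\<exists>h'<dep i + 3. (x, h') \<in> Avail h \<union> (Y1 \<union> Y2)"
      by (intro exI[of _ "Suc (Suc (dep i))"]) simp
  qed
  from yields_trans[OF Y this] show ?thesis
    unfolding f_def
    by (rule yields_mono) (use cardX in \<open>simp_all add: c2_def card_cartesian_product\<close>)
qed

lemma yields_fac:
  assumes k: "k < length C" "is_mul k" and i: "i \<in> I" "mexp k i \<noteq> 0"
  shows "\<exists>f e. poly (fac k i) (mpoly_const a) = f ^ e \<and> e \<le> s\<^sup>2 + 1 \<and>
    yields (Avail (dep k)) c2 {(f, dep k)}"
proof -
  note m = mexp(2-4)[OF k i(2)]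
  show ?thesis
  proof (cases "mexp k i \<le> s\<^sup>2")
    case True
    have "yields (Avail (dep k)) b {(poly (cutoff i) (mpoly_const a), Suc (dep i))}"
      using m(1,2) i(1) by (intro yields_eval cutoff_coeff_in_span) auto
    then have "yields (Avail (dep k)) b {(poly (cutoff i) (mpoly_const a), dep k)}"
      by (rule yields_weaken) (use m(2) in auto)
    moreover have "b \<le> c2"
    proof -
      have "1 \<le> card A" by (simp add: cardA)
      then have "1 * b \<le> card A * b" by (rule mult_right_mono) simp
      then show ?thesis unfolding c2_def mult_1 by linarith
    qed
    ultimately have "yields (Avail (dep k)) c2 {(poly (cutoff i) (mpoly_const a), dep k)}"
      by (elim yields_mono) auto
    then show ?thesis using True
      by (intro exI[of _ "poly (cutoff i) (mpoly_const a)"] exI[of _ "mexp k i"]) (simp add: fac_def)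
  next
    case False
    \<comment> \<open>An exponent above s^2 but at most s^(dep k - dep i) forces a gap of three,
      exactly the layers that the large power consumes.\<close>
    have "dep i + 3 \<le> dep k"
    proof (rule ccontr)
      assume "\<not> ?thesis"
      then have "s ^ (dep k - dep i) \<le> s ^ 2" if "1 \<le> s"
        using that by (intro power_increasing) auto
      moreover have "s \<ge> 1"
      proof (rule ccontr)
        assume "\<not> 1 \<le> s"
        then have "s ^ (dep k - dep i) = 0" using m(2) by (simp add: power_0_left)
        then show False using m(3) i(2) by linarith
      qed
      ultimately show False using m(3) False by simp
    qed
    moreover have "yields (Avail (dep k)) c2
        {(poly (poly_cutoff (Suc D) (V i ^ mexp k i)) (mpoly_const a), dep i + 3)}"
      using m(1,2) i(1) by (intro yields_large_power) auto
    ultimately have "yields (Avail (dep k)) c2 {(poly (fac k i) (mpoly_const a), dep k)}"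
      using False by (elim yields_weaken) (auto simp: fac_def)
    then show ?thesis by (intro exI[of _ "poly (fac k i) (mpoly_const a)"] exI[of _ 1]) simp
  qed
qed

definition c1 where "c1 = s * c2 + s * (s\<^sup>2 + 1)"

lemma yields_M:
  assumes k: "k < length C" "is_mul k"
  shows "yields (Avail (dep k)) c1 {(M k a, Suc (dep k))}"
proof -
  \<comment> \<open>Factors with exponent zero equal 1 and are dropped, as no depth bound is known
    for them.\<close>
  define J where "J = {i \<in> I. mexp k i \<noteq> 0}"
  have J: "finite J" "card J \<le> s" "J \<subseteq> I"
    using finite_I card_I card_mono[of I J] by (auto simp: J_def)
  have "\<forall>i\<in>J. \<exists>f e. poly (fac k i) (mpoly_const a) = f ^ e \<and> e \<le> s\<^sup>2 + 1 \<and>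
      yields (Avail (dep k)) c2 {(f, dep k)}"
    using yields_fac[OF k] by (simp add: J_def)
  from bchoice[OF this] obtain f where "\<forall>i\<in>J. \<exists>e. poly (fac k i) (mpoly_const a) = f i ^ e \<and>
      e \<le> s\<^sup>2 + 1 \<and> yields (Avail (dep k)) c2 {(f i, dep k)}"
    by blast
  from bchoice[OF this] obtain e where e: "\<forall>i\<in>J. poly (fac k i) (mpoly_const a) = f i ^ e i \<and>
      e i \<le> s\<^sup>2 + 1 \<and> yields (Avail (dep k)) c2 {(f i, dep k)}"
    by blast
  have "M k a = (\<Prod>i\<in>J. poly (fac k i) (mpoly_const a))"
    unfolding M_def using J finite_I
    by (intro prod.mono_neutral_right) (auto simp: J_def fac_def)
  then have M: "M k a = (\<Prod>i\<in>J. f i ^ e i)" using e by simp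
  define Y where "Y = (\<Union>i\<in>J. {(f i, dep k)})"
  have "yields (Avail (dep k)) (\<Sum>i\<in>J. c2) Y"
    unfolding Y_def using e J(1) by (intro yields_UN) auto
  moreover have "yields (Avail (dep k) \<union> Y) (\<Sum>i\<in>J. e i) {(M k a, Suc (dep k))}"
    unfolding M using J(1) by (intro yields_prod_power) (auto simp: Y_def)
  ultimately have "yields (Avail (dep k)) ((\<Sum>i\<in>J. c2) + (\<Sum>i\<in>J. e i)) (Y \<union> {(M k a, Suc (dep k))})"
    by (rule yields_trans)
  moreover have "(\<Sum>i\<in>J. c2) + (\<Sum>i\<in>J. e i) \<le> c1"
  proof -
    have "(\<Sum>i\<in>J. e i) \<le> card J * (s\<^sup>2 + 1)"
      using sum_bounded_above[of J e "s\<^sup>2 + 1"] e by simp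
    also have "\<dots> \<le> s * (s\<^sup>2 + 1)" using J(2) by (rule mult_right_mono) simp
    finally have "(\<Sum>i\<in>J. e i) \<le> s * (s\<^sup>2 + 1)" .
    moreover have "(\<Sum>i\<in>J. c2) \<le> s * c2" using J(2) by simp
    ultimately show ?thesis unfolding c1_def by (rule add_mono[rotated])
  qed
  ultimately show ?thesis by (elim yields_mono) auto
qed

lemma yields_Lv: "yields {} 0 (Lv \<times> {0})"
proof -
  have "yields {} 0 {(x, 0)}" if x: "x \<in> Lv" for x
  proof (cases "x = 1")
    case True
    then show ?thesis using yields_const[of "{}" 1 0] by simp
  next
    case False
    then obtain i y where i: "i \<in> R" "C ! i = Var y" "x = coeff (V i) 1"
      using x by (auto simp: Lv_def)
    obtain z where z: "G (mpoly_var y) = monom z 1" "\<exists>j c. z = mpoly_var j \<or> z = mpoly_const c"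
      using G_var by blast
    have "x = z" using i z(1) V_Var[OF R_less] by simp
    then show ?thesis using z(2) yields_var yields_const by blast
  qed
  then have "yields {} (\<Sum>x\<in>Lv. 0) (\<Union>x\<in>Lv. {(x, 0)})"
    by (intro yields_UN finite_Lv)
  then show ?thesis by (elim yields_mono) auto
qed

text \<open>Raising h by one adds precisely the products of depth h in C, whose factors need only
  what is already available. Each pair is built once, so the cost is linear in their number.\<close>

lemma yields_Avail: "yields {} (card (MA h) * c1) (Avail h)"
proof (induction h)
  case 0
  show ?case using yields_Lv by (simp add: Avail_def MA_def)
next
  case (Suc h)
  define N where "N = MA (Suc h) - MA h"
  have N: "finite N" "MA (Suc h) = MA h \<union> N" "MA h \<inter> N = {}"
    using finite_MA[of "Suc h"] by (auto simp: N_def MA_def)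
  define Y where "Y = (\<Union>x\<in>N. {(M (fst x) (snd x), Suc (dep (fst x)))})"
  have "yields (Avail h) (\<Sum>x\<in>N. c1) Y"
    unfolding Y_def
  proof (intro yields_UN N(1))
    fix x assume "x \<in> N"
    then have "dep (fst x) = h" "is_mul (fst x)" "fst x < length C"
      using R_less by (auto simp: N_def MA_def)
    then show "yields (Avail h) c1 {(M (fst x) (snd x), Suc (dep (fst x)))}"
      using yields_M by blast
  qed
  then have "yields {} (card (MA h) * c1 + (\<Sum>x\<in>N. c1)) (Avail h \<union> Y)"
    using Suc.IH by (intro yields_trans) simp_all
  moreover have "card (MA (Suc h)) = card (MA h) + card N"
    using N finite_MA by (simp add: card_Un_disjoint)
  moreover have "Avail (Suc h) \<subseteq> Avail h \<union> Y"
    using N(2) by (auto simp: Avail_def Y_def)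
  ultimately show ?case by (elim yields_mono) (simp_all add: add_mult_distrib)
qed

text \<open>The last layer of sums is deliberately left out: the coefficients are given as elements
  of a span, so that the sums of the next construction absorb it.\<close>

theorem truncation:
  "\<exists>B. finite B \<and> card B \<le> b \<and> yields {} ((s + 1) * card A * c1) (B \<times> {Suc (circuit_depth C)}) \<and>
    (\<forall>w\<le>D. coeff (G (last (circuit_vals C))) w \<in> mpoly.span B)"
proof -
  define l where "l = length C - 1"
  have C: "C \<noteq> []" using nonempty by simp
  have ne: "circuit_vals C \<noteq> []" "circuit_depths C \<noteq> []"
    using C by (metis length_0_conv length_circuit_vals, metis length_0_conv length_circuit_depths)
  have last: "last (circuit_vals C) = circuit_vals C ! l" "circuit_depth C = dep l"
  proof -
    have "circuit_depth C = last (circuit_depths C)"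
      by (simp only: circuit_depth_def circuit_depths_def)
    then show "circuit_depth C = dep l"
      using last_conv_nth[OF ne(2)] by (simp add: l_def dep_def)
  qed (use last_conv_nth[OF ne(1)] in \<open>simp add: l_def\<close>)
  have l: "l \<in> R" by (simp add: R_def l_def)
  let ?h = "Suc (dep l)"
  have "yields {} (card (MA ?h) * c1) (B ?h \<times> {?h})"
  proof (rule yields_weaken[OF yields_Avail])
    fix p d assume pd: "(p, d) \<in> B ?h \<times> {?h}"
    show "\<exists>d'\<le>d. (p, d') \<in> Avail ?h"
    proof (cases "p \<in> Lv")
      case True
      then show ?thesis by (intro exI[of _ 0]) (simp add: Avail_def)
    next
      case False
      then obtain k a where "(k, a) \<in> MA ?h" "p = M k a" using pd by (auto simp: B_def)
      then show ?thesis
        using pd by (intro exI[of _ "Suc (dep k)"]) (force simp: Avail_def MA_def)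
    qed
  qed
  moreover have "card (MA ?h) * c1 \<le> (s + 1) * card A * c1"
    using card_MA by (rule mult_right_mono) simp
  ultimately have "yields {} ((s + 1) * card A * c1) (B ?h \<times> {?h})"
    by (elim yields_mono) auto
  moreover have "coeff (G (last (circuit_vals C))) w \<in> mpoly.span (B ?h)" if "w \<le> D" for w
  proof -
    have "coeff (V l) w \<in> mpoly.span (B (if is_mul l then Suc (dep l) else dep l))"
      using l that by (rule V_coeff_in_span)
    also have "\<dots> \<subseteq> mpoly.span (B ?h)" by (intro mpoly.span_mono B_mono) simp
    finally show ?thesis by (simp add: V_def last)
  qed
  ultimately show ?thesis
    using finite_B card_B by (intro exI[of _ "B ?h"]) (simp add: last(2))
qed

end

section \<open>Homogenization and substitution of power series\<close>

lemma poly_mapping_add_induct [case_names zero single add]: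
  fixes p :: "'b \<Rightarrow>\<^sub>0 'c::comm_monoid_add"
  assumes "P 0" "\<And>a b. P (Poly_Mapping.single a b)" "\<And>f g. P f \<Longrightarrow> P g \<Longrightarrow> P (f + g)"
  shows "P p"
proof (induction p rule: update_induct)
  case (update f a b)
  have "Poly_Mapping.update a b f = f + Poly_Mapping.single a b"
    using update(1)
    by (intro poly_mapping_eqI) (auto simp: lookup_update lookup_add lookup_single in_keys_iff when_def)
  then show ?case using assms(2,3) update by simp
qed (rule assms(1))

section \<open>Exponent vectors and products of polynomials\<close>

lemma mon_deg_superset:
  assumes "finite S" "Poly_Mapping.keys m \<subseteq> S"
  shows "mon_deg m = (\<Sum>i\<in>S. Poly_Mapping.lookup m i)"
  unfolding mon_deg_def using assms by (intro sum.mono_neutral_left) (auto simp: in_keys_iff)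

lemma mon_deg_add: "mon_deg (a + b) = mon_deg a + mon_deg b"
proof -
  let ?S = "Poly_Mapping.keys a \<union> Poly_Mapping.keys b"
  have "mon_deg (a + b) = (\<Sum>i\<in>?S. Poly_Mapping.lookup (a + b) i)"
    using keys_add[of a b] by (intro mon_deg_superset) auto
  also have "\<dots> = mon_deg a + mon_deg b"
    by (simp add: mon_deg_superset[of ?S] lookup_add sum.distrib)
  finally show ?thesis .
qed

lemma mon_deg_0 [simp]: "mon_deg 0 = 0"
  by (simp add: mon_deg_def)

lemma mon_deg_eq_0_iff: "mon_deg m = 0 \<longleftrightarrow> m = 0"
proof
  assume "mon_deg m = 0"
  then have "\<forall>i\<in>Poly_Mapping.keys m. Poly_Mapping.lookup m i = 0" by (simp add: mon_deg_def)
  then show "m = 0" by (auto simp: in_keys_iff intro!: poly_mapping_eqI)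
qed simp

lemma lookup_le_mon_deg: "Poly_Mapping.lookup m i \<le> mon_deg m"
proof (cases "i \<in> Poly_Mapping.keys m")
  case True
  then show ?thesis unfolding mon_deg_def by (intro member_le_sum) auto
qed (simp add: in_keys_iff)

lemma finite_bounded_monomials:
  assumes "finite S"
  shows "finite {m :: nat \<Rightarrow>\<^sub>0 nat. Poly_Mapping.keys m \<subseteq> S \<and> (\<forall>i. Poly_Mapping.lookup m i \<le> g i)}"
    (is "finite ?M")
proof (rule finite_imageD)
  let ?r = "\<lambda>m :: nat \<Rightarrow>\<^sub>0 nat. restrict (Poly_Mapping.lookup m) S"
  have "?r ` ?M \<subseteq> PiE S (\<lambda>i. {..g i})" by auto
  then show "finite (?r ` ?M)" by (rule finite_subset) (simp add: finite_PiE assms)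
  show "inj_on ?r ?M"
  proof (rule inj_onI)
    fix m m' assume m: "m \<in> ?M" "m' \<in> ?M" "?r m = ?r m'"
    have "Poly_Mapping.lookup m i = Poly_Mapping.lookup m' i" for i
    proof (cases "i \<in> S")
      case True
      then show ?thesis using fun_cong[OF m(3), of i] by simp
    next
      case False
      then have "i \<notin> Poly_Mapping.keys m" "i \<notin> Poly_Mapping.keys m'" using m(1,2) by auto
      then show ?thesis by (simp add: in_keys_iff)
    qed
    then show "m = m'" by (rule poly_mapping_eqI)
  qed
qed

lemma finite_splittings: "finite {(a, b). a + b = (m :: nat \<Rightarrow>\<^sub>0 nat)}"
proof -
  let ?M = "{a. Poly_Mapping.keys a \<subseteq> Poly_Mapping.keys m \<and>
    (\<forall>i. Poly_Mapping.lookup a i \<le> Poly_Mapping.lookup m i)}"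
  have "a \<in> ?M" "b \<in> ?M" if "a + b = m" for a b
    using that by (auto simp: in_keys_iff lookup_add)
  then have "{(a, b). a + b = m} \<subseteq> ?M \<times> ?M" by blast
  then show ?thesis
    by (rule finite_subset) (intro finite_cartesian_product finite_bounded_monomials finite_keys)
qed

lemma lookup_mpoly_mult:
  fixes p q :: "'a::comm_ring_1 mpoly"
  shows "Poly_Mapping.lookup (p * q) m =
    (\<Sum>(a, b)\<in>{(a, b). a + b = m}. Poly_Mapping.lookup p a * Poly_Mapping.lookup q b)"
proof (induction p rule: poly_mapping_add_induct)
  case (single a c)
  show ?case
  proof (induction q rule: poly_mapping_add_induct)
    case (single b d)
    have "(\<Sum>(x, y)\<in>{(x, y). x + y = m}. Poly_Mapping.lookup (Poly_Mapping.single a c) x *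
        Poly_Mapping.lookup (Poly_Mapping.single b d) y)
      = (\<Sum>x\<in>{(x, y). x + y = m}. if x = (a, b) then c * d else 0)"
      by (intro sum.cong) (auto simp: lookup_single when_def split: if_splits)
    also have "\<dots> = (if a + b = m then c * d else 0)"
      by (simp add: sum.delta finite_splittings)
    finally show ?case by (simp add: mult_single lookup_single when_def)
  qed (simp_all add: distrib_left lookup_add sum.distrib case_prod_beta)
qed (simp_all add: distrib_right lookup_add sum.distrib case_prod_beta)

lemma lookup_mpoly_const_mult: "Poly_Mapping.lookup (mpoly_const c * p) m = c * Poly_Mapping.lookup (p :: 'a::comm_ring_1 mpoly) m"
proof (induction p rule: poly_mapping_add_induct)
  case (single a b)
  show ?case by (simp add: mpoly_const_def mult_single lookup_single when_def)
qed (simp_all add: distrib_left lookup_add)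

section \<open>The homogenizing substitution as a ring homomorphism\<close>

definition hom_mono :: "nat \<Rightarrow> (nat \<Rightarrow>\<^sub>0 nat) \<Rightarrow> 'a::comm_ring_1 mpoly poly poly" where
  "hom_mono n e = monom (monom (Poly_Mapping.single (Poly_Mapping.update n 0 e) 1)
    (mon_deg (Poly_Mapping.update n 0 e))) (Poly_Mapping.lookup e n)"

text \<open>The substitution \<open>x\<^sub>i \<mapsto> t x\<^sub>i\<close>, with the variable \<open>n\<close> turned into the outer polynomial variable.\<close>

definition homog :: "nat \<Rightarrow> 'a::comm_ring_1 mpoly \<Rightarrow> 'a mpoly poly poly" where
  "homog n p = (\<Sum>e\<in>Poly_Mapping.keys p. [:[:mpoly_const (Poly_Mapping.lookup p e):]:] * hom_mono n e)"

lemma homog_superset: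
  assumes "finite S" "Poly_Mapping.keys p \<subseteq> S"
  shows "homog n p = (\<Sum>e\<in>S. [:[:mpoly_const (Poly_Mapping.lookup p e):]:] * hom_mono n e)"
  unfolding homog_def using assms by (intro sum.mono_neutral_left) (auto simp: in_keys_iff)

lemma homog_0 [simp]: "homog n 0 = 0"
  by (simp add: homog_def)

lemma homog_add: "homog n (p + q) = homog n p + homog n q"
proof -
  let ?S = "Poly_Mapping.keys p \<union> Poly_Mapping.keys q"
  have "homog n (p + q) = (\<Sum>e\<in>?S. [:[:mpoly_const (Poly_Mapping.lookup (p + q) e):]:] * hom_mono n e)"
    using keys_add[of p q] by (intro homog_superset) auto
  also have "\<dots> = homog n p + homog n q"
    by (simp add: homog_superset[of ?S] lookup_add sum.distrib[symmetric] mpoly_const_add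
        smult_add_left[symmetric])
  finally show ?thesis .
qed

lemma homog_single: "homog n (Poly_Mapping.single e c) = [:[:mpoly_const c:]:] * hom_mono n e"
  by (subst homog_superset[of "{e}"]) auto

lemma update_0_add:
  "Poly_Mapping.update n 0 (a + b) = Poly_Mapping.update n 0 a + Poly_Mapping.update n (0::nat) b"
  by (rule poly_mapping_eqI) (simp add: lookup_update lookup_add)

lemma hom_mono_add: "hom_mono n (a + b) = hom_mono n a * hom_mono n b"
  by (simp add: hom_mono_def mult_monom mult_single update_0_add mon_deg_add lookup_add)

lemma homog_mult: "homog n (p * q) = homog n p * homog n q"
proof (induction p rule: poly_mapping_add_induct)
  case (single a c)
  show ?case
  proof (induction q rule: poly_mapping_add_induct)
    case (single b d)
    have "homog n (Poly_Mapping.single a c * Poly_Mapping.single b d)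
        = [:[:mpoly_const c:]:] * [:[:mpoly_const d:]:] * (hom_mono n a * hom_mono n b)"
      by (simp add: mult_single homog_single hom_mono_add mpoly_const_mult mult_ac)
    then show ?case by (simp only: homog_single mult_ac)
  qed (simp_all add: homog_add distrib_left)
qed (simp_all add: homog_add distrib_right)

lemma homog_const: "homog n (mpoly_const c) = [:[:mpoly_const c:]:]"
proof -
  have "Poly_Mapping.update n 0 (0 :: nat \<Rightarrow>\<^sub>0 nat) = 0"
    by (rule poly_mapping_eqI) (simp add: lookup_update)
  then show ?thesis
    using homog_single[of n 0 c] by (simp add: hom_mono_def mpoly_const_def one_pCons[symmetric] monom_0)
qed

lemma homog_var:
  "homog n (mpoly_var i) = (if i = n then monom 1 1 else [:monom (mpoly_var i) 1:])"
proof -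
  have "Poly_Mapping.update n 0 (Poly_Mapping.single i (1::nat)) = (if i = n then 0 else Poly_Mapping.single i 1)"
    by (rule poly_mapping_eqI) (simp add: lookup_update lookup_single when_def)
  moreover have "mon_deg (Poly_Mapping.single i 1) = 1" by (simp add: mon_deg_def)
  ultimately show ?thesis
    by (simp add: mpoly_var_def homog_single hom_mono_def monom_0 one_pCons[symmetric] lookup_single_not_eq)
qed

lemma coeff_homog_1_0:
  "coeff (coeff (homog n p) 1) 0 = mpoly_const (Poly_Mapping.lookup p (Poly_Mapping.single n 1))"
proof (induction p rule: poly_mapping_add_induct)
  case (single e c)
  show ?case
  proof (cases "e = Poly_Mapping.single n 1")
    case True
    have "Poly_Mapping.update n 0 e = 0"
      by (rule poly_mapping_eqI) (simp add: True lookup_update lookup_single when_def)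
    then show ?thesis by (simp add: True homog_single hom_mono_def)
  next
    case False
    have "\<not> (Poly_Mapping.lookup e n = 1 \<and> Poly_Mapping.update n 0 e = 0)"
    proof
      assume *: "Poly_Mapping.lookup e n = 1 \<and> Poly_Mapping.update n 0 e = 0"
      have "Poly_Mapping.lookup e i = Poly_Mapping.lookup (Poly_Mapping.single n 1) i" for i
      proof (cases "i = n")
        case False
        then have "Poly_Mapping.lookup e i = Poly_Mapping.lookup (Poly_Mapping.update n 0 e) i"
          by (simp add: lookup_update)
        then show ?thesis using * False by (simp add: lookup_single when_def)
      qed (use * in simp)
      then show False using False poly_mapping_eqI by blast
    qed
    then have "coeff (coeff (hom_mono n e :: 'a mpoly poly poly) 1) 0 = 0"
      by (auto simp: hom_mono_def mon_deg_eq_0_iff)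
    then show ?thesis using False
      by (simp add: homog_single lookup_single when_def)
  qed
qed (simp_all add: homog_add lookup_add mpoly_const_add)

section \<open>The partial derivative at the origin\<close>

lemma mpoly_eval_0: "mpoly_eval (\<lambda>_. 0) p = Poly_Mapping.lookup p 0"
proof -
  have "Poly_Mapping.lookup p e * (\<Prod>i\<in>Poly_Mapping.keys e. 0 ^ Poly_Mapping.lookup e i)
      = (if e = 0 then Poly_Mapping.lookup p 0 else 0)" for e
  proof (cases "e = 0")
    case False
    then obtain i where "i \<in> Poly_Mapping.keys e" by (metis keys_eq_empty equals0I)
    then have "(\<Prod>i\<in>Poly_Mapping.keys e. 0 ^ Poly_Mapping.lookup e i) = (0 :: 'a)"
      by (intro prod_zero) (auto simp: in_keys_iff zero_power intro!: bexI[of _ i])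
    then show ?thesis using False by simp
  qed simp
  then have "mpoly_eval (\<lambda>_. 0) p
      = (\<Sum>e\<in>Poly_Mapping.keys p. if e = 0 then Poly_Mapping.lookup p 0 else 0)"
    by (simp add: mpoly_eval_def)
  then show ?thesis by (simp add: in_keys_iff)
qed

lemma mpoly_eval_0_pderiv:
  "mpoly_eval (\<lambda>_. 0) (mpoly_pderiv n p) = Poly_Mapping.lookup p (Poly_Mapping.single n 1)"
proof -
  let ?u = "\<lambda>e :: nat \<Rightarrow>\<^sub>0 nat. Poly_Mapping.update n (Poly_Mapping.lookup e n - 1) e"
  \<comment> \<open>Two exponent vectors are lowered to 0: that of y and, because 0 - 1 = 0, the
    zero vector, whose term carries the factor 0.\<close>
  have "(of_nat (Poly_Mapping.lookup e n) * Poly_Mapping.lookup p e when ?u e = 0)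
      = (if e = Poly_Mapping.single n 1 then Poly_Mapping.lookup p e else 0)" for e
  proof (cases "e = Poly_Mapping.single n 1")
    case True
    have "?u e = 0"
      by (rule poly_mapping_eqI) (simp add: True lookup_update lookup_single when_def)
    then show ?thesis by (simp add: True)
  next
    case False
    have "Poly_Mapping.lookup e n = 0" if u: "?u e = 0"
    proof (rule ccontr)
      assume nz: "Poly_Mapping.lookup e n \<noteq> 0"
      have u': "Poly_Mapping.lookup (?u e) i = 0" for i using u by simp
      have "Poly_Mapping.lookup e i = Poly_Mapping.lookup (Poly_Mapping.single n 1) i" for i
        using u'[of i] nz by (auto simp: lookup_update lookup_single when_def split: if_splits)
      then show False using False poly_mapping_eqI by blast
    qed
    then show ?thesis using False by (auto simp: when_def)
  qed
  then have "mpoly_eval (\<lambda>_. 0) (mpoly_pderiv n p) = (\<Sum>e\<in>Poly_Mapping.keys p.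
      if e = Poly_Mapping.single n 1 then Poly_Mapping.lookup p e else 0)"
    unfolding mpoly_eval_0 mpoly_pderiv_def by (simp add: lookup_sum lookup_single)
  then show ?thesis by (simp add: in_keys_iff)
qed

text \<open>\<open>A\<close> agrees with the series \<open>f (t x)\<close> modulo \<open>t ^ (d + 1)\<close>.\<close>

definition tracks :: "nat \<Rightarrow> 'a::comm_ring_1 mps \<Rightarrow> 'a mpoly poly \<Rightarrow> bool" where
  "tracks d f A \<longleftrightarrow>
    (\<forall>w\<le>d. \<forall>m. Poly_Mapping.lookup (coeff A w) m = (if mon_deg m = w then f m else 0))"

text \<open>The power of t records the total degree, so for a splitting m = a + b only the summand i
  = \<open>mon_deg a\<close> of the convolution survives.\<close>

lemma tracks_mult:
  assumes "tracks d f A" "tracks d g B"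
  shows "tracks d (ps_times f g) (A * B)"
  unfolding tracks_def
proof (intro allI impI)
  fix w and m :: "nat \<Rightarrow>\<^sub>0 nat" assume w: "w \<le> d"
  let ?S = "{(a, b). a + b = m}"
  have "Poly_Mapping.lookup (coeff (A * B) w) m
      = (\<Sum>i\<le>w. \<Sum>(a, b)\<in>?S. Poly_Mapping.lookup (coeff A i) a * Poly_Mapping.lookup (coeff B (w - i)) b)"
    by (simp add: coeff_mult lookup_sum lookup_mpoly_mult)
  also have "\<dots> = (\<Sum>i\<le>w. \<Sum>(a, b)\<in>?S.
      if i = mon_deg a then (if mon_deg b = w - mon_deg a then f a * g b else 0) else 0)"
    using assms w by (intro sum.cong) (auto simp: tracks_def)
  also have "\<dots> = (\<Sum>(a, b)\<in>?S. \<Sum>i\<le>w.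
      if i = mon_deg a then (if mon_deg b = w - mon_deg a then f a * g b else 0) else 0)"
    by (subst sum.swap) (simp add: case_prod_beta)
  also have "\<dots> = (\<Sum>(a, b)\<in>?S. if mon_deg m = w then f a * g b else 0)"
    by (intro sum.cong) (auto simp: mon_deg_add)
  also have "\<dots> = (if mon_deg m = w then ps_times f g m else 0)"
    by (simp add: ps_times_def case_prod_beta)
  finally show "Poly_Mapping.lookup (coeff (A * B) w) m = (if mon_deg m = w then ps_times f g m else 0)" .
qed

lemma tracks_one: "tracks d ps_one 1"
  by (auto simp: tracks_def ps_one_def coeff_1 lookup_one when_def mon_deg_eq_0_iff)

lemma tracks_power: "tracks d f A \<Longrightarrow> tracks d (ps_pow f k) (A ^ k)"
  by (induction k) (simp_all add: tracks_one tracks_mult)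

lemma tracks_monomial: "tracks d (ps_monomial a) (monom (Poly_Mapping.single a 1) (mon_deg a))"
  by (auto simp: tracks_def ps_monomial_def lookup_single when_def)

text \<open>Turns the power series equation for \<open>phi\<close> into an identity of polynomials
  in t, the setting of the residue formula.\<close>

lemma tracks_subst:
  assumes "tracks d phi F"
  shows "tracks d (subst_var_ps n P phi) (poly (homog n P) F)"
proof -
  define g where "g e = ps_times (ps_monomial (Poly_Mapping.update n 0 e)) (ps_pow phi (Poly_Mapping.lookup e n))" for e
  have "tracks d (g e) (poly (hom_mono n e) F)" for e
    unfolding g_def hom_mono_def poly_monom
    by (intro tracks_mult tracks_monomial tracks_power assms)
  then have g: "Poly_Mapping.lookup (coeff (poly (hom_mono n e) F) w) m = (if mon_deg m = w then g e m else 0)"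
    if "w \<le> d" for e w m
    using that by (simp add: tracks_def)
  have "poly (homog n P) F = (\<Sum>e\<in>Poly_Mapping.keys P.
      [:mpoly_const (Poly_Mapping.lookup P e):] * poly (hom_mono n e) F)"
    by (simp add: homog_def poly_sum)
  then show ?thesis
    by (simp add: tracks_def subst_var_ps_def coeff_sum lookup_sum lookup_mpoly_const_mult g flip: g_def)
qed

text \<open>With finitely many variables every homogeneous component of \<open>phi\<close> is a
  polynomial.\<close>

lemma exists_tracks:
  assumes "ps_in_vars {..<n} phi"
  shows "\<exists>F. tracks d phi F"
proof -
  define h where "h w = Abs_poly_mapping (\<lambda>m. if mon_deg m = w then phi m else 0)" for w
  have h: "Poly_Mapping.lookup (h w) = (\<lambda>m. if mon_deg m = w then phi m else 0)" for w
  proof -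
    have "{m. (if mon_deg m = w then phi m else 0) \<noteq> 0} \<subseteq>
        {m. Poly_Mapping.keys m \<subseteq> {..<n} \<and> (\<forall>i. Poly_Mapping.lookup m i \<le> w)}"
      using assms lookup_le_mon_deg by (auto simp: ps_in_vars_def)
    then have "finite {m. (if mon_deg m = w then phi m else 0) \<noteq> 0}"
      by (rule finite_subset) (intro finite_bounded_monomials finite_lessThan)
    then show ?thesis unfolding h_def by (rule lookup_Abs_poly_mapping)
  qed
  have "tracks d phi (\<Sum>w\<le>d. monom (h w) w)"
    by (simp add: tracks_def coeff_sum h)
  then show ?thesis ..
qed

section \<open>The circuit for the root\<close>

text \<open>For a base of at least 2 every addition is paid by one more exponent. All size bounds
  become powers of one number, at the price of generous exponents.\<close>

lemma le_power_add: "a \<le> X ^ i \<Longrightarrow> b \<le> X ^ i \<Longrightarrow> 2 \<le> X \<Longrightarrow> a + b \<le> (X::nat) ^ Suc i"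
proof -
  assume "a \<le> X ^ i" "b \<le> X ^ i" "2 \<le> X"
  then have "a + b \<le> 2 * X ^ i" by simp
  also have "\<dots> \<le> X * X ^ i" using \<open>2 \<le> X\<close> by (rule mult_right_mono) simp
  finally show ?thesis by simp
qed

lemma le_power_mult: "a \<le> X ^ i \<Longrightarrow> b \<le> X ^ j \<Longrightarrow> a * b \<le> (X::nat) ^ (i + j)"
  by (simp add: power_add mult_le_mono)

lemma le_power_mono: "a \<le> X ^ i \<Longrightarrow> i \<le> j \<Longrightarrow> 2 \<le> X \<Longrightarrow> a \<le> (X::nat) ^ j"
  by (erule order_trans) (rule power_increasing; simp)

lemma (in graded_circuit) size_bounds:
  defines "X \<equiv> s + D + 2"
  shows "b \<le> X ^ 7" "(s + 1) * card A * c1 \<le> X ^ 22"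
proof -
  have X: "2 \<le> X" by (simp add: X_def)
  have base: "s \<le> X ^ 1" "s + 1 \<le> X ^ 1" "s + 2 \<le> X ^ 1" "D \<le> X ^ 1" "D + 1 \<le> X ^ 1" "1 \<le> X ^ 1"
    by (simp_all add: X_def)
  have "s\<^sup>2 + 1 \<le> (s + 1)\<^sup>2" by (simp add: power2_eq_square)
  also have "\<dots> \<le> X ^ 2" by (intro power_mono) (simp_all add: X_def)
  finally have s2: "s\<^sup>2 + 1 \<le> X ^ 2" .
  have "D * D + 1 \<le> (D + 1) * (D + 1)" by simp
  also have "\<dots> \<le> X ^ (1 + 1)" by (intro le_power_mult base)
  finally have D2: "D * D + 1 \<le> X ^ 2" by (simp add: numeral_2_eq_2)
  have "s * D * (s\<^sup>2 + 1) \<le> X ^ 4"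
    using le_power_mult[OF le_power_mult[OF base(1,4)] s2] by (simp add: eval_nat_numeral)
  then have "s * D * (s\<^sup>2 + 1) + (D * D + 1) \<le> X ^ Suc 4"
    using le_power_mono[OF D2, of 4] X by (intro le_power_add) simp_all
  then have A: "card A \<le> X ^ 5" unfolding cardA s_def by simp
  have "(s + 1) * card A \<le> X ^ (1 + 5)" by (intro le_power_mult base A)
  then have "b \<le> X ^ Suc 6"
    unfolding b_def using le_power_mono[OF base(3), of 6] X by (intro le_power_add) simp_all
  then show b: "b \<le> X ^ 7" by simp
  have 1: "card A * b \<le> X ^ 12" using le_power_mult[OF A b] by simp
  have 2: "card A * (D + 1) \<le> X ^ 6" using le_power_mult[OF A base(5)] by simp
  have 3: "card A * (D + 1) * D \<le> X ^ 7" using le_power_mult[OF 2 base(4)] by simp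
  have "card A * b + card A * (D + 1) * D \<le> X ^ Suc 12"
    using 1 le_power_mono[OF 3, of 12] X by (intro le_power_add) simp_all
  then have "c2 \<le> X ^ Suc 13"
    unfolding c2_def using le_power_mono[OF 2, of 13] X by (intro le_power_add) simp_all
  then have c2: "c2 \<le> X ^ 14" by simp
  have 4: "s * c2 \<le> X ^ 15" using le_power_mult[OF base(1) c2] by simp
  have 5: "s * (s\<^sup>2 + 1) \<le> X ^ 3" using le_power_mult[OF base(1) s2] by (simp add: eval_nat_numeral)
  have "c1 \<le> X ^ Suc 15"
    unfolding c1_def using 4 le_power_mono[OF 5, of 15] X by (intro le_power_add) simp_all
  then have "(s + 1) * card A * c1 \<le> X ^ (1 + 5 + Suc 15)"
    by (intro le_power_mult base A)
  then show "(s + 1) * card A * c1 \<le> X ^ 22" by simp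
qed

lemma coeff_poly_diagonal:
  fixes p :: "'a::comm_ring_1 poly poly"
  shows "coeff (poly p (monom c 1)) w = (\<Sum>b\<le>w. coeff (coeff p b) (w - b) * c ^ b)"
proof (induction p arbitrary: w)
  case (pCons a q)
  have m: "coeff (monom c (Suc 0) * r) w = (case w of 0 \<Rightarrow> 0 | Suc v \<Rightarrow> c * coeff r v)" for r :: "'a poly" and w
    by (simp add: monom_altdef coeff_pCons split: nat.split)
  show ?case
  proof (cases w)
    case 0
    then show ?thesis by (simp add: m)
  next
    case (Suc v)
    then show ?thesis
      by (simp add: m pCons.IH[unfolded One_nat_def] sum.atMost_Suc_shift sum_distrib_left mult_ac del: sum.atMost_Suc)
  qed
qed simp

text \<open>Under \<open>y \<mapsto> \<beta> t\<close> the coefficient of \<open>t ^ w\<close> is a polynomial in \<open>\<beta>\<close> of degree at most \<open>w\<close> whose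
  coefficients are the bihomogeneous parts of total degree \<open>w\<close>; interpolating in \<open>\<beta>\<close> separates them
  although the degree of \<open>P\<close> in \<open>y\<close> is not bounded.\<close>

lemma bihomogeneous_parts:
  fixes P :: "'a::field mpoly" and D :: nat
  assumes inf: "infinite (UNIV :: 'a set)" and C: "circuit_computes C P"
  defines "X \<equiv> circuit_size C + D + 2"
  shows "\<exists>B. finite B \<and> card B \<le> X ^ 8 \<and> yields {} (X ^ 23) (B \<times> {Suc (circuit_depth C)}) \<and>
    (\<forall>i j. i + j \<le> D \<longrightarrow> coeff (coeff (homog n P) j) i \<in> mpoly.span B)"
proof -
  define G where "G \<beta> p = poly (homog n p) (monom (mpoly_const \<beta>) 1)" for \<beta> :: 'a and p
  obtain A :: "'a set" where A: "finite A"
    "card A = circuit_size C * D * (circuit_size C ^ 2 + 1) + D * D + 1"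
    using infinite_arbitrarily_large[OF inf] by blast
  \<comment> \<open>The coefficient of t^w has degree at most w in the constant put for y, so D + 1
    values separate its parts for all w up to D.\<close>
  obtain E :: "'a set" where E: "finite E" "card E = D + 1"
    using infinite_arbitrarily_large[OF inf] by blast
  have wf: "wf_circuit C" and P: "last (circuit_vals C) = P"
    using C by (simp_all add: circuit_computes_def)
  have "graded_circuit (G \<beta>) C D A" for \<beta>
  proof
    fix p q c i
    show "G \<beta> (p + q) = G \<beta> p + G \<beta> q" by (simp add: G_def homog_add)
    show "G \<beta> (p * q) = G \<beta> p * G \<beta> q" by (simp add: G_def homog_mult)
    show "G \<beta> (mpoly_const c) = [:mpoly_const c:]" by (simp add: G_def homog_const)
    have "G \<beta> (mpoly_var i) = monom (if i = n then mpoly_const \<beta> else mpoly_var i) 1"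
      by (simp add: G_def homog_var poly_monom)
    then show "\<exists>x. G \<beta> (mpoly_var i) = monom x 1 \<and> (\<exists>j c. x = mpoly_var j \<or> x = mpoly_const c)"
      by auto
  qed (use wf A in auto)
  note gc = this
  have "\<forall>\<beta>. \<exists>B. finite B \<and> card B \<le> X ^ 7 \<and> yields {} (X ^ 22) (B \<times> {Suc (circuit_depth C)}) \<and>
      (\<forall>w\<le>D. coeff (G \<beta> P) w \<in> mpoly.span B)"
  proof
    fix \<beta>
    interpret graded_circuit "G \<beta>" C D A by (rule gc)
    obtain B' where "finite B'" "card B' \<le> b" "yields {} ((s + 1) * card A * c1) (B' \<times> {Suc (circuit_depth C)})"
        "\<forall>w\<le>D. coeff (G \<beta> (last (circuit_vals C))) w \<in> mpoly.span B'"
      using truncation by blast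
    moreover from this(3) have "yields {} (X ^ 22) (B' \<times> {Suc (circuit_depth C)})"
      using size_bounds(2) by (elim yields_mono) (simp_all add: X_def s_def)
    ultimately show "\<exists>B. finite B \<and> card B \<le> X ^ 7 \<and>
        yields {} (X ^ 22) (B \<times> {Suc (circuit_depth C)}) \<and> (\<forall>w\<le>D. coeff (G \<beta> P) w \<in> mpoly.span B)"
      using size_bounds(1) P unfolding X_def s_def by (intro exI[of _ B']) auto
  qed
  from choice[OF this] obtain B where B: "finite (B \<beta>)" "card (B \<beta>) \<le> X ^ 7"
      "yields {} (X ^ 22) (B \<beta> \<times> {Suc (circuit_depth C)})"
      "\<forall>w\<le>D. coeff (G \<beta> P) w \<in> mpoly.span (B \<beta>)" for \<beta>
    by blast
  define BB where "BB = (\<Union>\<beta>\<in>E. B \<beta>)"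
  have EX: "card E \<le> X" by (simp add: E X_def)
  have "card BB \<le> (\<Sum>\<beta>\<in>E. card (B \<beta>))" unfolding BB_def using E(1) by (rule card_UN_le)
  also have "\<dots> \<le> card E * X ^ 7"
    using sum_bounded_above[of E "\<lambda>\<beta>. card (B \<beta>)" "X ^ 7"] B(2) by simp
  also have "\<dots> \<le> X * X ^ 7" using EX by (rule mult_right_mono) simp
  finally have card: "card BB \<le> X ^ 8" by (simp flip: power_Suc)
  have "yields {} (\<Sum>\<beta>\<in>E. X ^ 22) (\<Union>\<beta>\<in>E. B \<beta> \<times> {Suc (circuit_depth C)})"
    using E(1) B(3) by (intro yields_UN)
  moreover have "(\<Sum>\<beta>\<in>E. X ^ 22) \<le> X ^ 23"
    using mult_right_mono[OF EX, of "X ^ 22"] by (simp flip: power_Suc)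
  ultimately have "yields {} (X ^ 23) (BB \<times> {Suc (circuit_depth C)})"
    by (elim yields_mono) (auto simp: BB_def)
  moreover have "coeff (coeff (homog n P) j) i \<in> mpoly.span BB" if ij: "i + j \<le> D" for i j
  proof -
    define w where "w = i + j"
    define g where "g = (\<Sum>b\<le>w. monom (coeff (coeff (homog n P) b) (w - b)) b)"
    have g: "coeff g b = (if b \<le> w then coeff (coeff (homog n P) b) (w - b) else 0)" for b
      by (simp add: g_def coeff_sum)
    have "poly g (mpoly_const \<beta>) = coeff (G \<beta> P) w" for \<beta>
      unfolding G_def coeff_poly_diagonal by (simp add: g_def poly_sum poly_monom)
    moreover have "degree g \<le> w" by (rule degree_le) (simp add: g)
    ultimately have "coeff g j \<in> mpoly.span ((\<lambda>\<beta>. coeff (G \<beta> P) w) ` E)"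
      using coeff_in_span_evals[OF E(1), of g j] E(2) ij by (simp add: w_def)
    moreover have "coeff (G \<beta> P) w \<in> mpoly.span BB" if "\<beta> \<in> E" for \<beta>
    proof -
      have "coeff (G \<beta> P) w \<in> mpoly.span (B \<beta>)" using B(4) ij by (simp add: w_def)
      also have "\<dots> \<subseteq> mpoly.span BB" using that by (intro mpoly.span_mono) (auto simp: BB_def)
      finally show ?thesis .
    qed
    ultimately have "coeff g j \<in> mpoly.span BB"
      by - (erule mpoly_span_trans, elim imageE, simp)
    then show ?thesis by (simp add: g w_def)
  qed
  ultimately show ?thesis
    using card E(1) B(1) by (intro exI[of _ BB]) (simp add: BB_def)
qed

text \<open>As t divides f, a term t^i y^j contributes only from t^(i+j) on. This is what allows P
  to be replaced by a polynomial of bounded degree.\<close>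

lemma trunc_eq_poly:
  fixes p q :: "'a::comm_ring_1 poly poly"
  assumes "coeff f 0 = 0" "\<And>i j. i + j \<le> D \<Longrightarrow> coeff (coeff p j) i = coeff (coeff q j) i"
  shows "trunc_eq D (poly p f) (poly q f)"
proof -
  have f: "monom 1 j dvd f ^ j" for j
  proof -
    have "monom 1 1 dvd f" using assms(1) by (simp add: monom_1_dvd_iff')
    then show ?thesis using dvd_power_same[of "monom 1 1" f j] by (simp add: monom_power)
  qed
  have "monom 1 (Suc D) dvd coeff (p - q) j * f ^ j" for j
  proof -
    have "monom 1 (Suc D - j) dvd coeff (p - q) j"
      using assms(2) by (simp add: monom_1_dvd_iff')
    then have "monom 1 (Suc D - j) * monom 1 j dvd coeff (p - q) j * f ^ j"
      using f by (rule mult_dvd_mono)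
    then have "monom 1 (Suc D - j + j) dvd coeff (p - q) j * f ^ j" by (simp add: mult_monom)
    then show ?thesis by (auto simp: monom_1_dvd_iff')
  qed
  then have "monom 1 (Suc D) dvd poly (p - q) f"
    unfolding poly_altdef by (intro dvd_sum) simp
  then show ?thesis by (simp add: monom_1_dvd_iff' trunc_eq_def)
qed

section \<open>Spans and degrees in the residue formula\<close>

lemma eval2_in_span:
  fixes p :: "'a::field mpoly poly poly"
  assumes "\<And>i j. coeff (coeff p j) i \<in> mpoly.span S"
  shows "poly (poly p [:mpoly_const b:]) (mpoly_const a) \<in> mpoly.span S"
proof (rule eval_in_span)
  fix w
  have "\<forall>j. coeff (coeff p j) w \<in> mpoly.span S" using assms by blast
  then show "coeff (poly p [:mpoly_const b:]) w \<in> mpoly.span S"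
  proof (induction p)
    case (pCons a q)
    have "coeff a w \<in> mpoly.span S" "\<forall>j. coeff (coeff q j) w \<in> mpoly.span S"
      using pCons.prems by (metis coeff_pCons_0, metis coeff_pCons_Suc)
    then show ?case using pCons.IH by (simp add: mpoly.span_add mpoly.span_scale)
  qed (simp add: mpoly.span_zero)
qed

lemma pderiv_coeff_in_span:
  fixes p :: "'a::field mpoly poly poly"
  assumes "\<And>i j. coeff (coeff p j) i \<in> mpoly.span S"
  shows "coeff (coeff (pderiv p) j) i \<in> mpoly.span S"
proof -
  have "coeff (coeff (pderiv p) j) i = mpoly_const (of_nat (Suc j)) * coeff (coeff p (Suc j)) i"
    by (simp add: coeff_pderiv of_nat_poly of_nat_mpoly del: of_nat_Suc)
  then show ?thesis using assms by (simp add: mpoly.span_scale)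
qed

lemma degree_poly_const_arg:
  fixes p :: "'a::comm_ring_1 poly poly"
  assumes "\<And>j. degree (coeff p j) \<le> D"
  shows "degree (poly p [:c:]) \<le> D"
  unfolding poly_altdef
proof (intro degree_sum_le)
  fix j
  have "degree (coeff p j * [:c ^ j:]) \<le> degree (coeff p j) + degree [:c ^ j:]"
    by (rule degree_mult_le)
  then show "degree (coeff p j * [:c:] ^ j) \<le> D" using assms[of j] by (simp add: poly_const_pow)
qed simp

text \<open>Serves both interpolation variables: \<open>y\<close> is the outer variable in one
  application and a constant in the other.\<close>

lemma degree_root_formula:
  fixes x y T :: "'b::comm_ring_1 poly"
  assumes "degree x \<le> D" "degree y \<le> D" "degree T \<le> D"
  shows "degree (x * (\<Sum>m<N. y ^ (N - Suc m) * (y - T) ^ m)) \<le> D * (N + 1)"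
proof -
  have "degree (y ^ (N - Suc m) * (y - T) ^ m) \<le> D * N" if "m < N" for m
  proof -
    have "degree (y ^ (N - Suc m)) \<le> D * (N - Suc m)"
      using degree_power_le[of y "N - Suc m"] mult_le_mono1[OF assms(2)] by (rule order_trans)
    moreover have "degree ((y - T) ^ m) \<le> D * m"
      using degree_power_le[of "y - T" m] mult_le_mono1[OF degree_diff_le[OF assms(2,3)]]
      by (rule order_trans)
    ultimately have "degree (y ^ (N - Suc m) * (y - T) ^ m) \<le> D * (N - Suc m) + D * m"
      using degree_mult_le[of "y ^ (N - Suc m)" "(y - T) ^ m"] by linarith
    also have "\<dots> = D * (N - Suc m + m)" by (rule add_mult_distrib2[symmetric])
    also have "\<dots> \<le> D * N" using that by (intro mult_le_mono2) simp
    finally show ?thesis .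
  qed
  then have "degree (\<Sum>m<N. y ^ (N - Suc m) * (y - T) ^ m) \<le> D * N"
    by (intro degree_sum_le) simp_all
  then show ?thesis
    using degree_mult_le[of x "\<Sum>m<N. y ^ (N - Suc m) * (y - T) ^ m"] assms(1) by simp
qed

lemma root_circuit:
  fixes P :: "'a::field mpoly" and C :: "'a gate list"
  assumes inf: "infinite (UNIV :: 'a set)" and C: "circuit_computes C P"
    and phi: "ps_in_vars {..<n} phi" "phi 0 = 0"
    and root: "subst_var_ps n P phi = (\<lambda>_. 0)"
    and simple: "mpoly_eval (\<lambda>_. 0) (mpoly_pderiv n P) \<noteq> 0"
  shows "\<exists>C' Q. circuit_computes C' Q \<and> is_trunc d phi Q \<and>
    circuit_size C' \<le> (circuit_size C + d + 3) ^ 28 \<and> circuit_depth C' \<le> circuit_depth C + 5"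
proof -
  \<comment> \<open>Total degree d would do for the root condition, but the term y must survive in T
    also when d = 0.\<close>
  define D where "D = d + 1"
  define N where "N = 4 * D"
  define X where "X = circuit_size C + D + 2"
  define \<delta> where "\<delta> = Suc (circuit_depth C)"
  define \<mu> where "\<mu> = Poly_Mapping.lookup P (Poly_Mapping.single n 1)"
  have X: "2 \<le> X" by (simp add: X_def)
  have \<mu>: "\<mu> \<noteq> 0" using simple by (simp add: mpoly_eval_0_pderiv \<mu>_def)
  obtain BB where BB: "finite BB" "card BB \<le> X ^ 8" "yields {} (X ^ 23) (BB \<times> {\<delta>})"
      "\<And>i j. i + j \<le> D \<Longrightarrow> coeff (coeff (homog n P) j) i \<in> mpoly.span BB"
    using bihomogeneous_parts[OF inf C, of D n] unfolding X_def \<delta>_def by blast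
  obtain f where f: "tracks D phi f" using exists_tracks[OF phi(1)] by blast
  have f0: "coeff f 0 = 0"
    using f phi(2) by (intro poly_mapping_eqI) (simp add: tracks_def mon_deg_eq_0_iff)

  define T where "T = (\<Sum>j\<le>D. monom (\<Sum>i\<le>D - j.
    monom (mpoly_const (inverse \<mu>) * coeff (coeff (homog n P) j) i) i) j)"
  have T: "coeff (coeff T j) i =
      (if i + j \<le> D then mpoly_const (inverse \<mu>) * coeff (coeff (homog n P) j) i else 0)" for i j
    by (auto simp: T_def coeff_sum)
  have T_span: "coeff (coeff T j) i \<in> mpoly.span BB" for i j
    using BB(4) by (simp add: T mpoly.span_scale mpoly.span_zero)
  have homog_root: "coeff (poly (homog n P) f) w = 0" if "w \<le> D" for w
    using tracks_subst[OF f, of n P] that root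
    by (intro poly_mapping_eqI) (simp add: tracks_def)
  have T_root: "coeff (poly T f) w = 0" if w: "w \<le> d" for w
  proof -
    have "trunc_eq D (poly T f) (poly ([:[:mpoly_const (inverse \<mu>):]:] * homog n P) f)"
      using f0 by (intro trunc_eq_poly) (simp_all add: T)
    then show ?thesis using w homog_root by (simp add: trunc_eq_def D_def)
  qed
  have T00: "coeff (coeff T 0) 0 = 0"
  proof -
    have "coeff (poly p f) 0 = coeff (coeff p 0) 0" for p :: "'a mpoly poly poly"
      using f0 by (cases p) (simp add: coeff_mult)
    then show ?thesis using homog_root[of 0] by (simp add: T)
  qed
  have T10: "coeff (coeff T 1) 0 = 1"
  proof -
    have "coeff (coeff T 1) 0 = mpoly_const (inverse \<mu>) * mpoly_const \<mu>"
      unfolding T coeff_homog_1_0 by (simp add: \<mu>_def D_def)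
    then show ?thesis using \<mu> by (simp flip: mpoly_const_mult)
  qed

  define Y :: "'a mpoly poly poly" where "Y = [:0, 1:]"
  define F where "F = pderiv T * (\<Sum>m<N. Y ^ (N - Suc m) * (Y - T) ^ m)"
  have F: "coeff (coeff F (N - 2)) w = coeff f w" if "w \<le> d" for w
  proof -
    have "N = 4 * (d + 1)" by (simp add: N_def D_def)
    from root_coefficient_formula[OF T00 T10 f0 T_root this that]
    show ?thesis by (simp only: F_def Y_def)
  qed

  obtain A :: "'a set" where A: "finite A" "card A = D * (N + 1) + 1"
    using infinite_arbitrarily_large[OF inf] by blast
  have dT: "degree T \<le> D"
    by (rule degree_le) (auto simp: poly_eq_iff T)
  have dTc: "degree (coeff T j) \<le> D" for j
    by (rule degree_le) (simp add: T)
  have dF: "degree F < card A"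
  proof -
    have "degree (pderiv T) \<le> D"
      using dT by (intro degree_le) (simp add: coeff_pderiv coeff_eq_0 del: of_nat_Suc)
    moreover have "degree Y \<le> D" by (simp add: Y_def D_def)
    ultimately have "degree F \<le> D * (N + 1)"
      unfolding F_def using dT by (intro degree_root_formula)
    then show ?thesis by (simp add: A(2))
  qed
  have polyF: "poly F [:c:] = poly (pderiv T) [:c:] *
      (\<Sum>m<N. [:c:] ^ (N - Suc m) * ([:c:] - poly T [:c:]) ^ m)" for c
    by (simp add: F_def Y_def poly_sum)
  have dFb: "degree (poly F [:c:]) < card A" for c
  proof -
    have "degree (coeff (pderiv T) j) \<le> D" for j
    proof (rule degree_le, intro allI impI)
      fix i assume "D < i"
      then have "coeff (coeff T (Suc j)) i = 0" by (simp add: T)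
      then show "coeff (coeff (pderiv T) j) i = 0"
        by (simp add: coeff_pderiv of_nat_poly del: of_nat_Suc)
    qed
    then have "degree (poly F [:c:]) \<le> D * (N + 1)"
      unfolding polyF using dTc by (intro degree_root_formula degree_poly_const_arg) simp_all
    then show ?thesis by (simp add: A(2))
  qed

  \<comment> \<open>At y = b and t = a the formula is a sum of b^(N-1-m) x z^m. Only the products x
    z^m need gates; the powers of b are wire constants.\<close>
  define x where "x = (\<lambda>(a, b). poly (poly (pderiv T) [:mpoly_const b:]) (mpoly_const a))"
  define z where "z = (\<lambda>(a, b). mpoly_const b - poly (poly T [:mpoly_const b:]) (mpoly_const a))"
  define I where "I = (A \<times> A) \<times> {..<N}"
  define U where "U = (\<lambda>(r, m). x r * z r ^ m) ` I"
  have finI: "finite I" and finAA: "finite (A \<times> A)" using A(1) by (simp_all add: I_def)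
  have x_span: "x r \<in> mpoly.span BB" for r
    unfolding x_def by (cases r) (simp add: eval2_in_span pderiv_coeff_in_span T_span)
  have z_span: "z r \<in> mpoly.span (insert 1 BB)" for r
  proof -
    obtain a b where r: "r = (a, b)" by fastforce
    have "poly (poly T [:mpoly_const b:]) (mpoly_const a) \<in> mpoly.span BB"
      by (rule eval2_in_span) (rule T_span)
    also have "\<dots> \<subseteq> mpoly.span (insert 1 BB)" by (intro mpoly.span_mono) auto
    finally have "poly (poly T [:mpoly_const b:]) (mpoly_const a) \<in> mpoly.span (insert 1 BB)" .
    moreover have "mpoly_const b * 1 \<in> mpoly.span (insert 1 BB)"
      by (intro mpoly.span_scale mpoly.span_base) simp
    ultimately show ?thesis by (simp add: z_def r mpoly.span_diff)
  qed
  have F_span: "coeff (coeff F k) w \<in> mpoly.span U" for k w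
  proof -
    have "coeff (coeff F k) w \<in> mpoly.span
        ((\<lambda>(a, b). poly (poly F [:mpoly_const b:]) (mpoly_const a)) ` (A \<times> A))"
      using A(1) dF dFb by (intro coeff_coeff_in_span_evals)
    moreover have "poly (poly F [:mpoly_const b:]) (mpoly_const a) \<in> mpoly.span U"
      if ab: "a \<in> A" "b \<in> A" for a b
    proof -
      have "poly (poly F [:mpoly_const b:]) (mpoly_const a)
          = (\<Sum>m<N. mpoly_const (b ^ (N - Suc m)) * (x (a, b) * z (a, b) ^ m))"
        unfolding polyF
        by (simp add: poly_sum sum_distrib_left x_def z_def mpoly_const_power mult_ac)
      also have "\<dots> \<in> mpoly.span U"
        using ab by (intro mpoly.span_sum mpoly.span_scale mpoly.span_base) (force simp: U_def I_def)
      finally show ?thesis .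
    qed
    ultimately show ?thesis
      by - (erule mpoly_span_trans, auto)
  qed
  define Q where "Q = (\<Sum>w\<le>d. coeff f w)"
  have Q_span: "Q \<in> mpoly.span U"
    unfolding Q_def using F F_span by (intro mpoly.span_sum) (metis atMost_iff)
  have Q_trunc: "is_trunc d phi Q"
    using f by (simp add: is_trunc_def Q_def lookup_sum tracks_def D_def)

  \<comment> \<open>The leaf 1 supplies the summand b of z.\<close>
  define Y0 where "Y0 = BB \<times> {\<delta>} \<union> {(1, 0)}"
  define Y1 where "Y1 = (\<Union>r\<in>A \<times> A. {(x r, Suc \<delta>)})"
  define Y2 where "Y2 = (\<Union>r\<in>A \<times> A. {(z r, Suc \<delta>)})"
  define Y3 where "Y3 = (\<Union>i\<in>I. {(x (fst i) * z (fst i) ^ snd i, Suc (Suc \<delta>))})"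
  have 0: "yields {} (X ^ 23 + 0) Y0"
    unfolding Y0_def using yields_const[of _ 1 0] by (intro yields_trans BB(3)) simp_all
  have 1: "yields Y0 (\<Sum>r\<in>A \<times> A. card BB) Y1"
    unfolding Y1_def
    by (intro yields_UN finAA yields_span BB(1) x_span) (auto simp: Y0_def)
  have 2: "yields (Y0 \<union> Y1) (\<Sum>r\<in>A \<times> A. card (insert 1 BB)) Y2"
    unfolding Y2_def
    by (intro yields_UN finAA yields_span z_span) (auto simp: Y0_def BB(1))
  have 3: "yields (Y0 \<union> (Y1 \<union> Y2)) (\<Sum>i\<in>I. N) Y3"
    unfolding Y3_def
  proof (intro yields_UN finI)
    fix i assume i: "i \<in> I"
    have r: "fst i \<in> A \<times> A" using i by (auto simp: I_def)
    have "(x (fst i), Suc \<delta>) \<in> Y1" "(z (fst i), Suc \<delta>) \<in> Y2"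
      unfolding Y1_def Y2_def by (rule UN_I[OF r], rule singletonI)+
    \<comment> \<open>The index type bool encodes a product of two powers: x with exponent 1 and z
      with exponent m.\<close>
    then have "yields (Y0 \<union> (Y1 \<union> Y2)) (\<Sum>b\<in>UNIV. if b then 1 else snd i)
        {(\<Prod>b\<in>UNIV. (if b then x (fst i) else z (fst i)) ^ (if b then 1 else snd i), Suc (Suc \<delta>))}"
      by (intro yields_prod_power) (auto intro!: exI[of _ "Suc \<delta>"])
    then show "yields (Y0 \<union> (Y1 \<union> Y2)) N {(x (fst i) * z (fst i) ^ snd i, Suc (Suc \<delta>))}"
      by (rule yields_mono) (use i in \<open>auto simp: UNIV_bool I_def mult.commute\<close>)
  qed
  have finU: "finite U" using finI by (simp add: U_def)
  have 4: "yields (Y0 \<union> ((Y1 \<union> Y2) \<union> Y3)) (card U) {(Q, Suc (Suc (Suc \<delta>)))}"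
  proof (rule yields_span[OF finU Q_span])
    fix u assume "u \<in> U"
    then have "(u, Suc (Suc \<delta>)) \<in> Y3" by (force simp: U_def Y3_def)
    then show "\<exists>h<Suc (Suc (Suc \<delta>)). (u, h) \<in> Y0 \<union> (Y1 \<union> Y2 \<union> Y3)"
      by (intro exI[of _ "Suc (Suc \<delta>)"]) simp
  qed
  define cost where "cost = X ^ 23 + 0 + ((\<Sum>r\<in>A \<times> A. card BB) + (\<Sum>r\<in>A \<times> A. card (insert 1 BB))
      + (\<Sum>i\<in>I. N) + card U)"
  have "yields {} cost (Y0 \<union> (Y1 \<union> Y2 \<union> Y3 \<union> {(Q, Suc (Suc (Suc \<delta>)))}))"
    unfolding cost_def
    using yields_trans[OF 0, of _ "Y1 \<union> Y2 \<union> Y3 \<union> {(Q, Suc (Suc (Suc \<delta>)))}"]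
      yields_trans[OF yields_trans[OF yields_trans[OF 1 2] 3] 4] by simp
  then have "yields {} cost {(Q, Suc (Suc (Suc \<delta>)))}" by (rule yields_mono) auto
  \<comment> \<open>Five layers beyond the depth of C: one in \<open>\<delta>\<close> for the
    truncation, then the values x and z, the products, the sum \<open>Q\<close>, and the copy of the
    output.\<close>
  then obtain C' where C': "circuit_computes C' Q" "circuit_size C' \<le> Suc cost"
      "circuit_depth C' \<le> Suc (Suc (Suc (Suc \<delta>)))"
    using circuit_of_yields by blast
  have "Suc cost \<le> X ^ 28"
  proof -
    have "D \<le> X ^ 1" "1 \<le> X ^ 1" "4 \<le> X ^ 2"
      using X power_mono[OF X, of 2] by (simp_all add: X_def)
    have N: "N \<le> X ^ 3" unfolding N_def
      using le_power_mult[OF \<open>4 \<le> X ^ 2\<close> \<open>D \<le> X ^ 1\<close>] by simp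
    then have "N + 1 \<le> X ^ Suc 3"
      using le_power_mono[OF \<open>1 \<le> X ^ 1\<close>, of 3] X by (intro le_power_add) simp_all
    then have "D * (N + 1) \<le> X ^ 5" using le_power_mult[OF \<open>D \<le> X ^ 1\<close>, of "N + 1" 4] by simp
    then have "card A \<le> X ^ Suc 5" unfolding A(2)
      using le_power_mono[OF \<open>1 \<le> X ^ 1\<close>, of 5] X by (intro le_power_add) simp_all
    then have AA: "card (A \<times> A) \<le> X ^ 12"
      using le_power_mult[of "card A" X 6 "card A" 6] by (simp add: card_cartesian_product)
    have I: "card I \<le> X ^ 15"
      unfolding I_def card_cartesian_product[of "A \<times> A"] using le_power_mult[OF AA N] by simp
    have "card (insert 1 BB) \<le> card BB + 1" using BB(1) by (simp add: card_insert_if)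
    also have "\<dots> \<le> X ^ Suc 8"
      using BB(2) le_power_mono[OF \<open>1 \<le> X ^ 1\<close>, of 8] X by (intro le_power_add) simp_all
    finally have B1: "card (insert 1 BB) \<le> X ^ 9" by simp
    have s1: "(\<Sum>r\<in>A \<times> A. card BB) \<le> X ^ 20"
      using le_power_mult[OF AA BB(2)] by simp
    have s2: "(\<Sum>r\<in>A \<times> A. card (insert 1 BB)) \<le> X ^ 21"
      using le_power_mult[OF AA B1] by simp
    have s3: "(\<Sum>i\<in>I. N) \<le> X ^ 18" using le_power_mult[OF I N] by simp
    have s4: "card U \<le> X ^ 15" unfolding U_def using card_image_le[OF finI] I by (rule order_trans)
    note le = le_power_mono[OF _ _ X]
    have "(\<Sum>r\<in>A \<times> A. card BB) + (\<Sum>r\<in>A \<times> A. card (insert 1 BB)) \<le> X ^ Suc 21"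
      using le[OF s1, of 21] s2 X by (intro le_power_add) simp_all
    then have "(\<Sum>r\<in>A \<times> A. card BB) + (\<Sum>r\<in>A \<times> A. card (insert 1 BB)) + (\<Sum>i\<in>I. N) \<le> X ^ Suc 22"
      using le[OF s3, of 22] X by (intro le_power_add) simp_all
    then have "(\<Sum>r\<in>A \<times> A. card BB) + (\<Sum>r\<in>A \<times> A. card (insert 1 BB)) + (\<Sum>i\<in>I. N) + card U \<le> X ^ Suc 23"
      using le[OF s4, of 23] X by (intro le_power_add) simp_all
    then have "cost \<le> X ^ Suc 24"
      unfolding cost_def using le[of "X ^ 23 + 0" 23 24] X by (intro le_power_add) simp_all
    then have "cost + 1 \<le> X ^ Suc 25"
      using le[of cost 25 25] le[OF \<open>1 \<le> X ^ 1\<close>, of 25] X by (intro le_power_add) simp_all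
    then show ?thesis using le[of "cost + 1" 26 28] by simp
  qed
  moreover have "X = circuit_size C + d + 3" by (simp add: X_def D_def)
  ultimately show ?thesis
    using C' Q_trunc by (intro exI[of _ C'] exI[of _ Q]) (simp add: \<delta>_def)
qed

theorem theorem4p1:
  assumes "infinite (UNIV :: 'a::field set)"
  shows "\<exists>(q :: real poly poly) (c :: nat).
    \<forall>(n :: nat) (P :: 'a mpoly) (C :: 'a gate list) (phi :: 'a mps).
      poly_in_vars {..n} P \<and> circuit_computes C P \<and>
      ps_in_vars {..<n} phi \<and> phi 0 = 0 \<and>
      subst_var_ps n P phi = (\<lambda>_. 0) \<and>
      mpoly_eval (\<lambda>_. 0) (mpoly_pderiv n P) \<noteq> 0 \<longrightarrow>
      (\<forall>d :: nat. \<exists>(C' :: 'a gate list) (Q :: 'a mpoly).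
         circuit_computes C' Q \<and> is_trunc d phi Q \<and>
         real (circuit_size C') \<le> poly (poly q [:real d:]) (real (circuit_size C)) \<and>
         circuit_depth C' \<le> circuit_depth C + c)"
proof (intro exI[of _ "[:[:3, 1:], 1:] ^ 28 :: real poly poly"] exI[of _ "5 :: nat"] allI impI, elim conjE)
  fix n P and C :: "'a gate list" and phi d
  assume asm: "circuit_computes C P" "ps_in_vars {..<n} phi" "phi 0 = 0"
    "subst_var_ps n P phi = (\<lambda>_. 0)" "mpoly_eval (\<lambda>_. 0) (mpoly_pderiv n P) \<noteq> 0"
  obtain C' Q where C': "circuit_computes C' Q" "is_trunc d phi Q"
      "circuit_size C' \<le> (circuit_size C + d + 3) ^ 28" "circuit_depth C' \<le> circuit_depth C + 5"
    using root_circuit[OF assms asm] by blast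
  have "real (circuit_size C') \<le> real ((circuit_size C + d + 3) ^ 28)"
    using C'(3) by (simp only: of_nat_le_iff)
  \<comment> \<open>The outer variable stands for the size and the inner one for d, so
    \<open>[:[:3, 1:], 1:]\<close> is their sum plus 3.\<close>
  also have "\<dots> = poly (poly ([:[:3, 1:], 1:] ^ 28) [:real d:]) (real (circuit_size C))"
    by (simp add: algebra_simps)
  finally show "\<exists>C' Q. circuit_computes C' Q \<and> is_trunc d phi Q \<and>
      real (circuit_size C') \<le> poly (poly ([:[:3, 1:], 1:] ^ 28) [:real d:]) (real (circuit_size C)) \<and>
      circuit_depth C' \<le> circuit_depth C + 5"
    using C' by blast
qed

end
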